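(* Consider an arbitrary nonuniform time mesh $0=t_0<t_1<\dots<t_N=T$. (a) Let $(\phi^n)_{0\le n\le N}$ be a solution of the first-order stabilized L1 scheme $$D_{n+1}^\alpha\phi=\gamma\,\mathcal G\left(\mathcal L\phi^{n+1}+\delta_\phi E_1(\phi^n)+\widetilde{\mathcal L}(\phi^{n+1}-\phi^n)\right),\qquad0\le n\le N-1,$$ for the Allen--Cahn, Cahn--Hilliard, or MBE (without slope selection) model, where in the Allen--Cahn case $\|\phi^0\|_\infty\le1$ is assumed. Then, with the classical discrete energy $E^n=\frac12\langle\phi^n,\mathcal L\phi^n\rangle+E_1(\phi^n)$, $$E^n\le E^0\qquad\text{for all }1\le n\le N.$$ (b) Let $(\phi^n,r^n)_{0\le n\le N}$ be a solution of the L1-SAV scheme, for $0\le n\le N-1$, $$D_{n+\frac12}^\alpha\phi=\gamma\,\mathcal G\mu^{n+\frac12},$$ $$\mu^{n+\frac12}=\mathcal L\phi^{n+\frac12}+\frac{r^{n+\frac12}}{\sqrt{E_1(\bar\phi^{n+\frac12})+C_0}}\,\delta_\phi E_1(\bar\phi^{n+\frac12}),$$ $$r^{n+1}-r^n=\frac{1}{2\sqrt{E_1(\bar\phi^{n+\frac12})+C_0}}\left\langle\delta_\phi E_1(\bar\phi^{n+\frac12}),\phi^{n+1}-\phi^n\right\rangle,$$ where $\phi^{n+\frac12}=\frac12(\phi^{n+1}+\phi^n)$, $r^{n+\frac12}=\frac12(r^{n+1}+r^n)$, $\bar\phi^{n+\frac12}=\frac32\phi^n-\frac12\phi^{n-1}$,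 for the Allen--Cahn, Cahn--Hilliard, or MBE (with or without slope selection) model. Then, with the modified energy $E^n=\frac12\langle\mathcal L\phi^n,\phi^n\rangle+(r^n)^2$, $$E^n\le E^0\qquad\text{for all }1\le n\le N.$$
   Context: Let $\alpha\in(0,1)$, $\gamma>0$, $\varepsilon>0$, $T>0$, and $\tau_j=t_j-t_{j-1}>0$ for $1\le j\le N$. $\Omega$ is a bounded rectangular box with periodic boundary conditions; $\langle\cdot,\cdot\rangle$ is the $L^2(\Omega)$ inner product, $\|\cdot\|_\infty$ the sup norm. Each $\phi^n$ is a periodic function on $\Omega$, smooth enough that all expressions make sense, each $r^n$ is a real number; $\phi^0$, $r^0$ and the starting value $\phi^{-1}$ (needed only in $\bar\phi^{\frac12}$) are given. $C_0>0$ is a constant such that the quantities under the square roots are positive. Discrete derivatives on the mesh: $D_j\phi=\phi^j-\phi^{j-1}$, $$D_n^\alpha\phi=\sum_{j=1}^n d_{n,j}D_j\phi,\qquad D_{n+\frac12}^\alpha\phi=\sum_{j=0}^n\bar d_{n,j}D_{j+1}\phi,$$ with $$d_{n,j}=\frac{(t_n-t_{j-1})^{1-\alpha}-(t_n-t_j)^{1-\alpha}}{\Gamma(2-\alpha)\tau_j}\quad(1\le j\le n),$$ $$\bar d_{n,j}=\frac{(t_{n+1}+t_n-2t_j)^{1-\alpha}-(t_{n+1}+t_n-2t_{j+1})^{1-\alpha}}{\Gamma(2-\alpha)2^{1-\alpha}\tau_{j+1}}\quad(0\le j<n),\qquad\bar d_{n,n}=\frac{(t_{n+1}-t_n)^{1-\alpha}}{\Gamma(2-\alpha)2^{1-\alpha}\tau_{n+1}}.$$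 Models ($\delta_\phi E_1$ is the $L^2$ variational derivative of $E_1$): (i) Allen--Cahn: $\mathcal G=-1$, $\mathcal L=-\varepsilon^2\Delta$, $E_1(\phi)=\int_\Omega F(\phi)\,dx$ with $F(\phi)=\frac14(1-\phi^2)^2$, $\delta_\phi E_1(\phi)=\phi^3-\phi$; in scheme (a), $\widetilde{\mathcal L}=S$ with constant $S\ge2$. (ii) Cahn--Hilliard: $\mathcal G=\Delta$ (with inverse on mean-zero functions), $\mathcal L=-\varepsilon^2\Delta$, $E_1(\phi)=\int_\Omega F(\phi)\,dx$, $\delta_\phi E_1(\phi)=F'(\phi)$, with $F(\phi)=\frac14(1-\phi^2)^2$; in scheme (a), $F$ is replaced (also in the energy) by a truncated ($C^2$) version with $\sup_{s\in\mathbb R}|F''(s)|\le L$ for some constant $L>0$, and $\widetilde{\mathcal L}=S$ with constant $S\ge L/2$. (iii) MBE: $\mathcal G=-1$, $\mathcal L=\varepsilon^2\Delta^2$, $E_1(\phi)=\int_\Omega F_{\rm m}(\nabla\phi)\,dx$, $\delta_\phi E_1(\phi)=\nabla\cdot\mathbf f_{\rm m}(\nabla\phi)$, with either $F_{\rm m}(\nabla\phi)=\frac14(1-|\nabla\phi|^2)^2$, $\mathbf f_{\rm m}(\nabla\phi)=\nabla\phi-|\nabla\phi|^2\nabla\phi$ (with slope selection), or $F_{\rm m}(\nabla\phi)=-\frac12\ln(1+|\nabla\phi|^2)$, $\mathbf f_{\rm m}(\nabla\phi)=\frac{\nabla\phi}{1+|\nabla\phi|^2}$ (without slope selection); in scheme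 (a) (without slope selection only), $\widetilde{\mathcal L}=-S\Delta$ with constant $S\ge\frac1{16}$. *)

theory Defs
  imports "HOL-Analysis.Analysis"
begin

section \<open>Periodic functions on a box\<close>

text \<open>
  A function on the periodic box with opposite corners \<open>a\<close> and \<open>b\<close> is represented by its
  periodic extension to the whole space; \<open>i\<close> ranges over the standard basis.
\<close>

definition periodic_on_box :: "'a::euclidean_space \<Rightarrow> 'a \<Rightarrow> ('a \<Rightarrow> real) \<Rightarrow> bool" where
  "periodic_on_box a b u \<longleftrightarrow> (\<forall>x. \<forall>i\<in>Basis. u (x + ((b - a) \<bullet> i) *\<^sub>R i) = u x)"

definition partial :: "'a::euclidean_space \<Rightarrow> ('a \<Rightarrow> real) \<Rightarrow> 'a \<Rightarrow> real" where
  "partial i u x = frechet_derivative u (at x) i"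

primrec Ck :: "nat \<Rightarrow> ('a::euclidean_space \<Rightarrow> real) \<Rightarrow> bool" where
  "Ck 0 u \<longleftrightarrow> continuous_on UNIV u"
| "Ck (Suc k) u \<longleftrightarrow> (\<forall>x. u differentiable (at x)) \<and> (\<forall>i\<in>Basis. Ck k (partial i u))"

definition grad :: "('a::euclidean_space \<Rightarrow> real) \<Rightarrow> 'a \<Rightarrow> 'a" where
  "grad u x = (\<Sum>i\<in>Basis. partial i u x *\<^sub>R i)"

definition divergence :: "('a::euclidean_space \<Rightarrow> 'a) \<Rightarrow> 'a \<Rightarrow> real" where
  "divergence v x = (\<Sum>i\<in>Basis. partial i (\<lambda>y. v y \<bullet> i) x)"

definition laplacian :: "('a::euclidean_space \<Rightarrow> real) \<Rightarrow> 'a \<Rightarrow> real" where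
  "laplacian u x = (\<Sum>i\<in>Basis. partial i (partial i u) x)"

definition L2_inner :: "'a::euclidean_space \<Rightarrow> 'a \<Rightarrow> ('a \<Rightarrow> real) \<Rightarrow> ('a \<Rightarrow> real) \<Rightarrow> real" where
  "L2_inner a b u v = integral (cbox a b) (\<lambda>x. u x * v x)"

definition sup_norm :: "'a::euclidean_space \<Rightarrow> 'a \<Rightarrow> ('a \<Rightarrow> real) \<Rightarrow> real" where
  "sup_norm a b u = (SUP x\<in>cbox a b. \<bar>u x\<bar>)"


section \<open>Time mesh and discrete fractional derivatives\<close>

definition time_mesh :: "real \<Rightarrow> nat \<Rightarrow> (nat \<Rightarrow> real) \<Rightarrow> bool" where
  "time_mesh T N t \<longleftrightarrow> t 0 = 0 \<and> t N = T \<and> (\<forall>j<N. t j < t (Suc j))"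

definition L1_coeff :: "real \<Rightarrow> (nat \<Rightarrow> real) \<Rightarrow> nat \<Rightarrow> nat \<Rightarrow> real" where
  "L1_coeff \<alpha> t n j =
     ((t n - t (j - 1)) powr (1 - \<alpha>) - (t n - t j) powr (1 - \<alpha>)) /
     (Gamma (2 - \<alpha>) * (t j - t (j - 1)))"

definition L1_deriv ::
  "real \<Rightarrow> (nat \<Rightarrow> real) \<Rightarrow> (nat \<Rightarrow> 'a \<Rightarrow> real) \<Rightarrow> nat \<Rightarrow> 'a \<Rightarrow> real" where
  "L1_deriv \<alpha> t \<phi> n x = (\<Sum>j=1..n. L1_coeff \<alpha> t n j * (\<phi> j x - \<phi> (j - 1) x))"

definition L1_half_coeff :: "real \<Rightarrow> (nat \<Rightarrow> real) \<Rightarrow> nat \<Rightarrow> nat \<Rightarrow> real" where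
  "L1_half_coeff \<alpha> t n j =
     (if j < n then
        ((t (n + 1) + t n - 2 * t j) powr (1 - \<alpha>)
           - (t (n + 1) + t n - 2 * t (j + 1)) powr (1 - \<alpha>)) /
        (Gamma (2 - \<alpha>) * 2 powr (1 - \<alpha>) * (t (j + 1) - t j))
      else
        (t (n + 1) - t n) powr (1 - \<alpha>) /
        (Gamma (2 - \<alpha>) * 2 powr (1 - \<alpha>) * (t (n + 1) - t n)))"

text \<open>The derivative at the midpoint of the step from \<open>t n\<close> to \<open>t (n + 1)\<close>:\<close>

definition L1_half_deriv ::
  "real \<Rightarrow> (nat \<Rightarrow> real) \<Rightarrow> (nat \<Rightarrow> 'a \<Rightarrow> real) \<Rightarrow> nat \<Rightarrow> 'a \<Rightarrow> real" where
  "L1_half_deriv \<alpha> t \<phi> n x = (\<Sum>j=0..n. L1_half_coeff \<alpha> t n j * (\<phi> (j + 1) x - \<phi> j x))"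


section \<open>The phase-field models\<close>

definition double_well :: "real \<Rightarrow> real" where
  "double_well s = 1/4 * (1 - s^2)^2"

text \<open>A \<open>C\<^sup>2\<close> potential that agrees with the double well near the origin:\<close>

definition truncated_double_well :: "real \<Rightarrow> (real \<Rightarrow> real) \<Rightarrow> bool" where
  "truncated_double_well L F \<longleftrightarrow>
     Ck 2 F \<and> (\<forall>s. \<bar>deriv (deriv F) s\<bar> \<le> L) \<and>
     (\<exists>M>0. \<forall>s. \<bar>s\<bar> \<le> M \<longrightarrow> F s = double_well s)"

text \<open>The Cahn--Hilliard model carries its potential, which is truncated in one of the schemes.\<close>

datatype model = Allen_Cahn | Cahn_Hilliard "real \<Rightarrow> real" | MBE_slope | MBE_no_slope

fun mobility :: "model \<Rightarrow> ('a::euclidean_space \<Rightarrow> real) \<Rightarrow> 'a \<Rightarrow> real" where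
  "mobility (Cahn_Hilliard F) u = laplacian u"
| "mobility _ u = (\<lambda>x. - u x)"

fun linear_part :: "real \<Rightarrow> model \<Rightarrow> ('a::euclidean_space \<Rightarrow> real) \<Rightarrow> 'a \<Rightarrow> real" where
  "linear_part \<epsilon> Allen_Cahn u = (\<lambda>x. - (\<epsilon>^2) * laplacian u x)"
| "linear_part \<epsilon> (Cahn_Hilliard F) u = (\<lambda>x. - (\<epsilon>^2) * laplacian u x)"
| "linear_part \<epsilon> MBE_slope u = (\<lambda>x. \<epsilon>^2 * laplacian (laplacian u) x)"
| "linear_part \<epsilon> MBE_no_slope u = (\<lambda>x. \<epsilon>^2 * laplacian (laplacian u) x)"

fun E1 :: "'a::euclidean_space \<Rightarrow> 'a \<Rightarrow> model \<Rightarrow> ('a \<Rightarrow> real) \<Rightarrow> real" where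
  "E1 a b Allen_Cahn u = integral (cbox a b) (\<lambda>x. double_well (u x))"
| "E1 a b (Cahn_Hilliard F) u = integral (cbox a b) (\<lambda>x. F (u x))"
| "E1 a b MBE_slope u = integral (cbox a b) (\<lambda>x. 1/4 * (1 - (norm (grad u x))^2)^2)"
| "E1 a b MBE_no_slope u = integral (cbox a b) (\<lambda>x. - (1/2) * ln (1 + (norm (grad u x))^2))"

text \<open>The \<open>L\<^sup>2\<close> variational derivative of \<^const>\<open>E1\<close>:\<close>

fun dE1 :: "model \<Rightarrow> ('a::euclidean_space \<Rightarrow> real) \<Rightarrow> 'a \<Rightarrow> real" where
  "dE1 Allen_Cahn u = (\<lambda>x. (u x)^3 - u x)"
| "dE1 (Cahn_Hilliard F) u = (\<lambda>x. deriv F (u x))"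
| "dE1 MBE_slope u = divergence (\<lambda>x. grad u x - (norm (grad u x))^2 *\<^sub>R grad u x)"
| "dE1 MBE_no_slope u = divergence (\<lambda>x. grad u x /\<^sub>R (1 + (norm (grad u x))^2))"

fun is_MBE :: "model \<Rightarrow> bool" where
  "is_MBE MBE_slope = True"
| "is_MBE MBE_no_slope = True"
| "is_MBE _ = False"

text \<open>
  All differential operators act classically. A phase field is periodic and \<open>C\<^sup>2\<close>, for MBE
  with \<open>C\<^sup>2\<close> Laplacian. For Cahn--Hilliard no more than \<open>C\<^sup>2\<close> is asked of the phase field
  itself; the argument of the outer Laplacian is asked to be \<open>C\<^sup>2\<close>, which
  \<open>admissible_potential\<close> expresses.
\<close>

definition phase_field :: "'a::euclidean_space \<Rightarrow> 'a \<Rightarrow> model \<Rightarrow> ('a \<Rightarrow> real) \<Rightarrow> bool" where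
  "phase_field a b m u \<longleftrightarrow>
     periodic_on_box a b u \<and> Ck 2 u \<and> (is_MBE m \<longrightarrow> Ck 2 (laplacian u))"

fun admissible_potential :: "model \<Rightarrow> ('a::euclidean_space \<Rightarrow> real) \<Rightarrow> bool" where
  "admissible_potential (Cahn_Hilliard F) \<mu> \<longleftrightarrow> Ck 2 \<mu>"
| "admissible_potential _ \<mu> \<longleftrightarrow> True"


section \<open>The stabilized L1 scheme\<close>

fun stabilization :: "model \<Rightarrow> real \<Rightarrow> ('a::euclidean_space \<Rightarrow> real) \<Rightarrow> 'a \<Rightarrow> real" where
  "stabilization Allen_Cahn S u = (\<lambda>x. S * u x)"
| "stabilization (Cahn_Hilliard F) S u = (\<lambda>x. S * u x)"
| "stabilization MBE_slope S u = (\<lambda>x. - S * laplacian u x)"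
| "stabilization MBE_no_slope S u = (\<lambda>x. - S * laplacian u x)"

text \<open>MBE with slope selection is not covered by the stabilized scheme.\<close>

fun stabilized_model :: "model \<Rightarrow> real \<Rightarrow> bool" where
  "stabilized_model Allen_Cahn S \<longleftrightarrow> S \<ge> 2"
| "stabilized_model (Cahn_Hilliard F) S \<longleftrightarrow> (\<exists>L>0. truncated_double_well L F \<and> S \<ge> L / 2)"
| "stabilized_model MBE_slope S \<longleftrightarrow> False"
| "stabilized_model MBE_no_slope S \<longleftrightarrow> S \<ge> 1/16"

definition stabilized_potential ::
  "real \<Rightarrow> model \<Rightarrow> real \<Rightarrow> (nat \<Rightarrow> 'a::euclidean_space \<Rightarrow> real) \<Rightarrow> nat \<Rightarrow> 'a \<Rightarrow> real" where
  "stabilized_potential \<epsilon> m S \<phi> n x =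
     linear_part \<epsilon> m (\<phi> (n + 1)) x + dE1 m (\<phi> n) x
       + stabilization m S (\<lambda>y. \<phi> (n + 1) y - \<phi> n y) x"

definition stabilized_L1_solution ::
  "real \<Rightarrow> real \<Rightarrow> real \<Rightarrow> 'a::euclidean_space \<Rightarrow> 'a \<Rightarrow> nat \<Rightarrow> (nat \<Rightarrow> real) \<Rightarrow> model \<Rightarrow> real \<Rightarrow>
   (nat \<Rightarrow> 'a \<Rightarrow> real) \<Rightarrow> bool" where
  "stabilized_L1_solution \<alpha> \<gamma> \<epsilon> a b N t m S \<phi> \<longleftrightarrow>
     (\<forall>n\<le>N. phase_field a b m (\<phi> n)) \<and>
     (\<forall>n<N. admissible_potential m (stabilized_potential \<epsilon> m S \<phi> n) \<and>
        (\<forall>x. L1_deriv \<alpha> t \<phi> (n + 1) x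
             = \<gamma> * mobility m (stabilized_potential \<epsilon> m S \<phi> n) x))"

definition classical_energy ::
  "real \<Rightarrow> 'a::euclidean_space \<Rightarrow> 'a \<Rightarrow> model \<Rightarrow> ('a \<Rightarrow> real) \<Rightarrow> real" where
  "classical_energy \<epsilon> a b m u = 1/2 * L2_inner a b u (linear_part \<epsilon> m u) + E1 a b m u"


section \<open>The L1-SAV scheme\<close>

text \<open>
  Here \<open>n\<close> stands for the half-integer index \<open>n + 1/2\<close>, and \<open>\<phi>m\<close> is the starting value with
  index \<open>-1\<close>.
\<close>

definition extrapolate ::
  "('a \<Rightarrow> real) \<Rightarrow> (nat \<Rightarrow> 'a \<Rightarrow> real) \<Rightarrow> nat \<Rightarrow> 'a \<Rightarrow> real" where
  "extrapolate \<phi>m \<phi> n x = 3/2 * \<phi> n x - 1/2 * (if n = 0 then \<phi>m x else \<phi> (n - 1) x)"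

definition SAV_root ::
  "'a::euclidean_space \<Rightarrow> 'a \<Rightarrow> model \<Rightarrow> real \<Rightarrow> ('a \<Rightarrow> real) \<Rightarrow> (nat \<Rightarrow> 'a \<Rightarrow> real) \<Rightarrow> nat \<Rightarrow> real" where
  "SAV_root a b m C0 \<phi>m \<phi> n = sqrt (E1 a b m (extrapolate \<phi>m \<phi> n) + C0)"

definition SAV_potential ::
  "real \<Rightarrow> 'a::euclidean_space \<Rightarrow> 'a \<Rightarrow> model \<Rightarrow> real \<Rightarrow> ('a \<Rightarrow> real) \<Rightarrow> (nat \<Rightarrow> 'a \<Rightarrow> real) \<Rightarrow>
   (nat \<Rightarrow> real) \<Rightarrow> nat \<Rightarrow> 'a \<Rightarrow> real" where
  "SAV_potential \<epsilon> a b m C0 \<phi>m \<phi> r n x =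
     linear_part \<epsilon> m (\<lambda>y. 1/2 * (\<phi> (n + 1) y + \<phi> n y)) x
       + (1/2 * (r (n + 1) + r n)) / SAV_root a b m C0 \<phi>m \<phi> n * dE1 m (extrapolate \<phi>m \<phi> n) x"

definition L1_SAV_solution ::
  "real \<Rightarrow> real \<Rightarrow> real \<Rightarrow> 'a::euclidean_space \<Rightarrow> 'a \<Rightarrow> nat \<Rightarrow> (nat \<Rightarrow> real) \<Rightarrow> model \<Rightarrow> real \<Rightarrow>
   ('a \<Rightarrow> real) \<Rightarrow> (nat \<Rightarrow> 'a \<Rightarrow> real) \<Rightarrow> (nat \<Rightarrow> real) \<Rightarrow> bool" where
  "L1_SAV_solution \<alpha> \<gamma> \<epsilon> a b N t m C0 \<phi>m \<phi> r \<longleftrightarrow>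
     periodic_on_box a b \<phi>m \<and> Ck 2 \<phi>m \<and>
     (\<forall>n\<le>N. phase_field a b m (\<phi> n)) \<and>
     (\<forall>n<N. E1 a b m (extrapolate \<phi>m \<phi> n) + C0 > 0 \<and>
        admissible_potential m (SAV_potential \<epsilon> a b m C0 \<phi>m \<phi> r n) \<and>
        (\<forall>x. L1_half_deriv \<alpha> t \<phi> n x
             = \<gamma> * mobility m (SAV_potential \<epsilon> a b m C0 \<phi>m \<phi> r n) x) \<and>
        r (n + 1) - r n
          = 1 / (2 * SAV_root a b m C0 \<phi>m \<phi> n)
            * L2_inner a b (dE1 m (extrapolate \<phi>m \<phi> n)) (\<lambda>x. \<phi> (n + 1) x - \<phi> n x))"

definition SAV_energy ::
  "real \<Rightarrow> 'a::euclidean_space \<Rightarrow> 'a \<Rightarrow> model \<Rightarrow> ('a \<Rightarrow> real) \<Rightarrow> real \<Rightarrow> real" where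
  "SAV_energy \<epsilon> a b m u \<rho> = 1/2 * L2_inner a b (linear_part \<epsilon> m u) u + \<rho>^2"

end

theory Submission
  imports Defs
begin

text \<open>
Both schemes are tested with the increment \<open>D\<^sub>k = \<phi>\<^sup>k\<^sup>+\<^sup>1 - \<phi>\<^sup>k\<close>. On the side of the energy, one step changes the
energy by at most \<open>\<langle>\<mu>\<^sub>k, D\<^sub>k\<rangle>\<close>, where \<open>\<mu>\<^sub>k\<close> is the chemical potential of that step: for the SAV scheme
this is an equality (\<open>SAV_energy_increment\<close>), since midpoint values turn the products into
differences of squares; for the stabilized scheme the stabilization term absorbs the second-order
Taylor remainder of the explicit nonlinearity (\<open>classical_energy_increment_le\<close>). No single step need
dissipate, because the fractional derivative has memory; but the increments summed up to any time
step are at most \<open>\<Sum>\<^sub>k \<langle>\<mu>\<^sub>k, D\<^sub>k\<rangle>\<close>, and this sum is nonpositive (\<open>scheme_dissipation\<close>).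

The sign of the sum comes from the memory kernel: for every real sequence \<open>v\<close> the form
\<open>\<Sum>\<^sub>k v\<^sub>k \<Sum>\<^sub>j\<^sub>\<le>\<^sub>k b\<^sub>k\<^sub>j v\<^sub>j\<close> is nonnegative. Summation by parts writes it in terms of the squares of the sums
\<open>v\<^sub>j + \<dots> + v\<^sub>k\<close>, and the weights of these squares are nonnegative as soon as a few mixed differences of
\<open>b\<close> have the right sign (\<open>dissipative_kernel_form_ge\<close>). The kernels of both schemes are difference
quotients of \<open>s \<mapsto> s\<^sup>r\<close> with \<open>r = 1 - \<alpha>\<close>, a concave function whose derivative is convex; this and
one explicit estimate for the midpoint scheme (\<open>powr_diagonal_excess_antimono\<close>) give the signs on
every mesh (\<open>dissipative_power_kernel\<close>).

For Allen--Cahn and MBE the kernel form is applied pointwise to \<open>D\<^sub>k x\<close> and integrated. For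
Cahn--Hilliard the natural inner product is that of \<open>H\<^sup>-\<^sup>1\<close>, yet no Poisson equation has to be solved:
the scheme is a lower triangular system for the \<open>D\<^sub>k\<close> with right-hand sides \<open>\<gamma> \<Delta>\<mu>\<^sub>k\<close>, so solving it
presents each \<open>D\<^sub>k\<close> as the Laplacian of a combination \<open>\<psi>\<^sub>k\<close> of \<open>\<mu>\<^sub>0, \<dots>, \<mu>\<^sub>k\<close>, and Green's identity reduces
the sum to the kernel form of the gradients of the \<open>\<psi>\<^sub>k\<close> (\<open>dissipation_H_minus_1\<close>).

Integration by parts on the periodic box rests on translation invariance: the integral of a
periodic function over the box does not change under shifts, so the integral of its derivative
vanishes. In the Allen--Cahn case the Taylor remainder is controlled only where \<open>|\<phi>| \<le> 1\<close>, which a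
discrete maximum principle provides (\<open>Allen_Cahn_maximum_principle\<close>).
\<close>

section \<open>Dissipative kernels\<close>

definition backward_diff :: "(nat \<Rightarrow> real) \<Rightarrow> nat \<Rightarrow> real" where
  "backward_diff c j = (if j = 0 then c 0 else c j - c (j - 1))"

lemma sum_backward_diff: "(\<Sum>j\<le>n. backward_diff c j) = c n"
  by (induction n) (simp_all add: backward_diff_def)

lemma backward_diff_scale: "backward_diff (\<lambda>j. a * c j) j = a * backward_diff c j"
  by (simp add: backward_diff_def right_diff_distrib)

text \<open>
Summation by parts; \<open>sum v {j..n}\<close> is the tail whose square appears in the kernel form below.
\<close>

lemma sum_mult_eq_sum_backward_diff:
  "(\<Sum>j\<le>n. c j * v j) = (\<Sum>j\<le>n. backward_diff c j * sum v {j..n})"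
proof (induction n)
  case 0
  show ?case by (simp add: backward_diff_def)
next
  case (Suc n)
  have "(\<Sum>j\<le>Suc n. backward_diff c j * sum v {j..Suc n})
      = (\<Sum>j\<le>n. backward_diff c j * (sum v {j..n} + v (Suc n)))
        + backward_diff c (Suc n) * v (Suc n)"
    by simp
  also have "\<dots> = (\<Sum>j\<le>n. c j * v j) + c n * v (Suc n) + backward_diff c (Suc n) * v (Suc n)"
    by (simp add: Suc distrib_left sum.distrib sum_backward_diff flip: sum_distrib_right)
  also have "\<dots> = (\<Sum>j\<le>Suc n. c j * v j)"
    by (simp add: backward_diff_def algebra_simps)
  finally show ?case ..
qed

text \<open>
The kernel form up to index \<open>k\<close> stays above half the sum of these weights times squared tails. The
extra \<open>b k k\<close> on the diagonal comes from the square \<open>(v k)\<^sup>2\<close> that is left over when the products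
\<open>v k * sum v {j..k}\<close> are completed to squares.
\<close>

definition row_weight :: "(nat \<Rightarrow> nat \<Rightarrow> real) \<Rightarrow> nat \<Rightarrow> nat \<Rightarrow> real" where
  "row_weight b k j = backward_diff (b k) j + (if j = k then b k k else 0)"

text \<open>
The conditions under which the weights are nonnegative and can be passed on from one row to the
next. The doubled diagonal matters: in a midpoint scheme the newest interval carries only half of
its mass, and the diagonal entry can be smaller than its left neighbour.
\<close>

definition dissipative_kernel :: "nat \<Rightarrow> (nat \<Rightarrow> nat \<Rightarrow> real) \<Rightarrow> bool" where
  "dissipative_kernel N b \<longleftrightarrow>
     (\<forall>k<N. 0 < b k k) \<and>
     (\<forall>k<N. \<forall>j\<le>k. 0 \<le> row_weight b k j) \<and>
     (\<forall>k. Suc k < N \<longrightarrow> (\<forall>j\<le>k. backward_diff (b (Suc k)) j \<le> row_weight b k j))"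

text \<open>
By induction on \<open>n\<close>. Put \<open>V\<^sub>j = v\<^sub>j + \<dots> + v\<^sub>n\<close>, \<open>w = v\<^sub>n\<^sub>+\<^sub>1\<close>, and let \<open>\<beta>\<^sub>j\<close> be the backward differences of the new row.
Its contribution \<open>w (\<Sum> \<beta>\<^sub>j V\<^sub>j + b w)\<close>, where \<open>b\<close> is the new diagonal entry, is half of
\<open>\<Sum> \<beta>\<^sub>j (V\<^sub>j + w)\<^sup>2 - \<Sum> \<beta>\<^sub>j V\<^sub>j\<^sup>2\<close> plus the diagonal weight times \<open>w\<^sup>2\<close>.
The subtracted sum is covered by the induction hypothesis, because the differences of the new row
do not exceed the weights of the old one.
\<close>

lemma dissipative_kernel_form_ge:
  assumes "dissipative_kernel N b" "n < N"
  shows "(\<Sum>j\<le>n. row_weight b n j * (sum v {j..n})\<^sup>2) / 2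
           \<le> (\<Sum>k\<le>n. v k * (\<Sum>j\<le>k. b k j * v j))"
  using assms(2)
proof (induction n)
  case 0
  show ?case by (simp add: row_weight_def backward_diff_def power2_eq_square)
next
  case (Suc n)
  define w where "w = v (Suc n)"
  define V where "V j = sum v {j..n}" for j
  define \<beta> where "\<beta> = backward_diff (b (Suc n))"
  have "(\<Sum>j\<le>n. \<beta> j * (V j)\<^sup>2) \<le> (\<Sum>j\<le>n. row_weight b n j * (V j)\<^sup>2)"
    using assms(1) Suc.prems
    by (intro sum_mono mult_right_mono) (auto simp: dissipative_kernel_def \<beta>_def)
  then have le: "(\<Sum>j\<le>n. \<beta> j * (V j)\<^sup>2) / 2 \<le> (\<Sum>k\<le>n. v k * (\<Sum>j\<le>k. b k j * v j))"
    using Suc.IH Suc.prems by (simp add: V_def)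
  have row: "(\<Sum>j\<le>Suc n. b (Suc n) j * v j)
      = (\<Sum>j\<le>n. \<beta> j * V j) + b (Suc n) (Suc n) * w"
  proof -
    have "(\<Sum>j\<le>Suc n. b (Suc n) j * v j)
        = (\<Sum>j\<le>n. \<beta> j * (V j + w)) + \<beta> (Suc n) * w"
      by (subst sum_mult_eq_sum_backward_diff) (simp add: V_def flip: \<beta>_def w_def)
    also have "\<dots> = (\<Sum>j\<le>n. \<beta> j * V j) + (\<Sum>j\<le>Suc n. \<beta> j) * w"
      by (simp add: distrib_left distrib_right sum.distrib sum_distrib_right)
    finally show ?thesis
      by (simp only: \<beta>_def sum_backward_diff)
  qed
  have split: "(\<Sum>j\<le>n. \<beta> j) + \<beta> (Suc n) = b (Suc n) (Suc n)"
    using sum_backward_diff[of "b (Suc n)" "Suc n"] by (simp add: \<beta>_def)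
  have "(\<Sum>j\<le>Suc n. row_weight b (Suc n) j * (sum v {j..Suc n})\<^sup>2)
      = (\<Sum>j\<le>n. \<beta> j * (V j + w)\<^sup>2) + (\<beta> (Suc n) + b (Suc n) (Suc n)) * w\<^sup>2"
    by (simp add: row_weight_def V_def \<beta>_def w_def)
  also have "(\<Sum>j\<le>n. \<beta> j * (V j + w)\<^sup>2)
      = (\<Sum>j\<le>n. \<beta> j * (V j)\<^sup>2) + 2 * w * (\<Sum>j\<le>n. \<beta> j * V j) + (\<Sum>j\<le>n. \<beta> j) * w\<^sup>2"
    by (simp add: sum.distrib sum_distrib_left sum_distrib_right power2_eq_square algebra_simps)
  finally have "(\<Sum>j\<le>Suc n. row_weight b (Suc n) j * (sum v {j..Suc n})\<^sup>2)
      = (\<Sum>j\<le>n. \<beta> j * (V j)\<^sup>2) + 2 * w * (\<Sum>j\<le>n. \<beta> j * V j)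
        + ((\<Sum>j\<le>n. \<beta> j) + \<beta> (Suc n) + b (Suc n) (Suc n)) * w\<^sup>2"
    by (simp add: algebra_simps)
  then have "(\<Sum>j\<le>Suc n. row_weight b (Suc n) j * (sum v {j..Suc n})\<^sup>2) / 2
      = (\<Sum>j\<le>n. \<beta> j * (V j)\<^sup>2) / 2 + w * (\<Sum>j\<le>Suc n. b (Suc n) j * v j)"
    by (simp only: split row) (simp add: power2_eq_square algebra_simps)
  then show ?case
    using le by (simp add: w_def)
qed

lemma dissipative_kernel_form_nonneg:
  assumes "dissipative_kernel N b" "n \<le> N"
  shows "0 \<le> (\<Sum>k<n. v k * (\<Sum>j\<le>k. b k j * v j))"
proof (cases n)
  case (Suc m)
  have "0 \<le> (\<Sum>j\<le>m. row_weight b m j * (sum v {j..m})\<^sup>2) / 2"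
    using assms Suc by (intro divide_nonneg_nonneg sum_nonneg mult_nonneg_nonneg)
      (auto simp: dissipative_kernel_def)
  also have "\<dots> \<le> (\<Sum>k\<le>m. v k * (\<Sum>j\<le>k. b k j * v j))"
    using assms Suc by (intro dissipative_kernel_form_ge) auto
  finally show ?thesis
    by (simp add: Suc lessThan_Suc_atMost)
qed simp

lemma dissipative_kernel_scale:
  assumes "dissipative_kernel N b" "0 < c"
  shows "dissipative_kernel N (\<lambda>k j. c * b k j)"
proof -
  have weight: "row_weight (\<lambda>k j. c * b k j) k j = c * row_weight b k j" for k j
    by (simp add: row_weight_def backward_diff_scale distrib_left)
  show ?thesis
    using assms unfolding dissipative_kernel_def weight backward_diff_scale by auto
qed

section \<open>Kernels generated by a power function\<close>

lemma powr_slope_mvt: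
  fixes r x y :: real
  assumes "0 < r" "0 \<le> x" "x < y"
  obtains \<xi> where "x < \<xi>" "\<xi> < y" "(y powr r - x powr r) / (y - x) = r * \<xi> powr (r - 1)"
proof -
  have "\<exists>l z. x < z \<and> z < y \<and> ((\<lambda>s. s powr r) has_real_derivative l) (at z)
      \<and> y powr r - x powr r = (y - x) * l"
  proof (rule MVT)
    show "continuous_on {x..y} (\<lambda>s. s powr r)"
      using assms by (intro continuous_on_powr') (auto intro!: continuous_intros)
    show "(\<lambda>s. s powr r) differentiable (at s)" if "x < s" "s < y" for s
      unfolding real_differentiable_def using that assms
      by (intro exI[of _ "r * s powr (r - 1)"]) (auto intro!: derivative_eq_intros)
  qed (use assms in auto)
  then obtain l z where z: "x < z" "z < y" "((\<lambda>s. s powr r) has_real_derivative l) (at z)"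
    "y powr r - x powr r = (y - x) * l" by blast
  have "l = r * z powr (r - 1)"
    using z assms by (intro DERIV_unique[OF z(3)]) (auto intro!: derivative_eq_intros)
  then show thesis
    using that z assms by simp
qed

lemma powr_slope_decreasing:
  fixes r x y z :: real
  assumes "0 < r" "r < 1" "0 \<le> x" "x < y" "y < z"
  shows "(z powr r - y powr r) / (z - y) \<le> (y powr r - x powr r) / (y - x)"
proof -
  obtain \<xi> where \<xi>: "x < \<xi>" "\<xi> < y" "(y powr r - x powr r) / (y - x) = r * \<xi> powr (r - 1)"
    using powr_slope_mvt[of r x y] assms by auto
  obtain \<eta> where \<eta>: "y < \<eta>" "(z powr r - y powr r) / (z - y) = r * \<eta> powr (r - 1)"
    using powr_slope_mvt[of r y z] assms by auto
  show ?thesis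
    using \<xi> \<eta> assms by (auto intro!: powr_mono2')
qed

lemma powr_increment_antimono:
  fixes r x y d :: real
  assumes "0 < r" "r < 1" "0 \<le> x" "x \<le> y" "0 \<le> d"
  shows "(y + d) powr r - y powr r \<le> (x + d) powr r - x powr r"
proof -
  have "(\<lambda>s. (s + d) powr r - s powr r) y \<le> (\<lambda>s. (s + d) powr r - s powr r) x"
  proof (rule DERIV_nonpos_imp_decreasing_open[OF assms(4)])
    show "continuous_on {x..y} (\<lambda>s. (s + d) powr r - s powr r)"
      using assms by (intro continuous_intros continuous_on_powr') auto
    fix s assume s: "x < s" "s < y"
    have "((\<lambda>s. (s + d) powr r - s powr r) has_real_derivative
        r * (s + d) powr (r - 1) - r * s powr (r - 1)) (at s)"
      using s assms by (auto intro!: derivative_eq_intros)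
    moreover have "(s + d) powr (r - 1) \<le> s powr (r - 1)"
      using s assms by (intro powr_mono2') auto
    ultimately show "\<exists>D. ((\<lambda>s. (s + d) powr r - s powr r) has_real_derivative D) (at s) \<and> D \<le> 0"
      using assms by (intro exI conjI) (auto simp: mult_left_mono)
  qed
  then show ?thesis by simp
qed

text \<open>
The derivative of \<open>s \<mapsto> s\<^sup>r\<close> is convex, hence \<open>s \<mapsto> s\<^sup>r - (s + d)\<^sup>r\<close> is concave and its slopes decrease.
The left end \<open>x = 0\<close> is included, where only continuity is left; this is needed next to the
diagonal of the kernel.
\<close>

lemma powr_slope_difference_antimono:
  fixes r x y z d :: real
  assumes "0 < r" "r < 1" "0 \<le> x" "x < y" "y < z" "0 \<le> d"
  shows "((y + d) powr r - (x + d) powr r) / (y - x) - ((z + d) powr r - (y + d) powr r) / (z - y)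
         \<le> (y powr r - x powr r) / (y - x) - (z powr r - y powr r) / (z - y)"
proof -
  define g where "g s = s powr r - (s + d) powr r" for s
  have deriv: "(g has_real_derivative r * s powr (r - 1) - r * (s + d) powr (r - 1)) (at s)"
    if "0 < s" for s
    unfolding g_def using that assms by (auto intro!: derivative_eq_intros)
  have mvt: "\<exists>\<xi>. u < \<xi> \<and> \<xi> < v \<and> (g v - g u) / (v - u) = r * (\<xi> powr (r - 1) - (\<xi> + d) powr (r - 1))"
    if "0 \<le> u" "u < v" for u v
  proof -
    have "\<exists>l \<xi>. u < \<xi> \<and> \<xi> < v \<and> (g has_real_derivative l) (at \<xi>) \<and> g v - g u = (v - u) * l"
    proof (rule MVT)
      show "continuous_on {u..v} g"
        unfolding g_def using assms that by (intro continuous_intros continuous_on_powr') auto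
      show "g differentiable (at s)" if "u < s" "s < v" for s
        using deriv[of s] that \<open>0 \<le> u\<close> by (auto simp: real_differentiable_def)
    qed (use that in auto)
    then obtain l \<xi> where \<xi>: "u < \<xi>" "\<xi> < v" "(g has_real_derivative l) (at \<xi>)" "g v - g u = (v - u) * l"
      by blast
    have "l = r * \<xi> powr (r - 1) - r * (\<xi> + d) powr (r - 1)"
      using deriv[of \<xi>] \<xi> that by (intro DERIV_unique[OF \<xi>(3)]) auto
    moreover have "(g v - g u) / (v - u) = l"
      using \<xi>(4) that by simp
    ultimately show ?thesis
      using \<xi>(1,2) by (intro exI[of _ \<xi>]) (simp add: right_diff_distrib)
  qed
  obtain \<xi> where \<xi>: "x < \<xi>" "\<xi> < y"
    "(g y - g x) / (y - x) = r * (\<xi> powr (r - 1) - (\<xi> + d) powr (r - 1))"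
    using mvt[of x y] assms by auto
  obtain \<eta> where \<eta>: "y < \<eta>" "\<eta> < z"
    "(g z - g y) / (z - y) = r * (\<eta> powr (r - 1) - (\<eta> + d) powr (r - 1))"
    using mvt[of y z] assms by auto
  have "(\<lambda>s. s powr (r - 1) - (s + d) powr (r - 1)) \<eta> \<le> (\<lambda>s. s powr (r - 1) - (s + d) powr (r - 1)) \<xi>"
  proof (rule DERIV_nonpos_imp_nonincreasing[where f = "\<lambda>s. s powr (r - 1) - (s + d) powr (r - 1)"])
    show "\<xi> \<le> \<eta>" using \<xi> \<eta> by simp
    fix s assume "\<xi> \<le> s" "s \<le> \<eta>"
    then have s: "0 < s" using \<xi> assms by simp
    have "((\<lambda>s. s powr (r - 1) - (s + d) powr (r - 1)) has_real_derivative
        (r - 1) * (s powr (r - 2) - (s + d) powr (r - 2))) (at s)"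
      using s assms by (auto intro!: derivative_eq_intros simp: algebra_simps)
    moreover have "(s + d) powr (r - 2) \<le> s powr (r - 2)"
      using s assms by (intro powr_mono2') auto
    ultimately show "\<exists>D. ((\<lambda>s. s powr (r - 1) - (s + d) powr (r - 1)) has_real_derivative D) (at s) \<and> D \<le> 0"
      using assms by (intro exI conjI) (auto simp: mult_nonpos_nonneg)
  qed
  then have "(g z - g y) / (z - y) \<le> (g y - g x) / (y - x)"
    using assms by (simp add: \<xi> \<eta>)
  then show ?thesis
    by (simp add: g_def diff_divide_distrib)
qed

text \<open>
Let \<open>h\<close> be the distance from the collocation point back to the preceding mesh point. Then \<open>h\<^sup>r / h\<close>
bounds the doubled diagonal entry of the kernel from below, and its excess over the left
neighbour is the right-hand side. It decreases in \<open>h\<close> because the mean value theorem bounds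
\<open>(r/p) (s\<^sup>r\<^sup>-\<^sup>1 - (s + p)\<^sup>r\<^sup>-\<^sup>1)\<close> by \<open>r (1 - r) s\<^sup>r\<^sup>-\<^sup>2 \<le> (1 - r) s\<^sup>r\<^sup>-\<^sup>2\<close>. Comparison with a full step \<open>k\<close>
reduces midpoint collocation to collocation at mesh points.
\<close>

lemma powr_diagonal_excess_antimono:
  fixes r h k p :: real
  assumes "0 < r" "r < 1" "0 < h" "h \<le> k" "0 < p"
  shows "k powr r / k - ((k + p) powr r - k powr r) / p
         \<le> h powr r / h - ((h + p) powr r - h powr r) / p"
proof -
  define G where "G s = s powr (r - 1) - ((s + p) powr r - s powr r) / p" for s
  have "G k \<le> G h"
  proof (rule DERIV_nonpos_imp_nonincreasing[OF assms(4)])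
    fix s assume "h \<le> s" "s \<le> k"
    then have s: "0 < s" using assms by simp
    have deriv: "(G has_real_derivative
        (r - 1) * s powr (r - 2) - (r * (s + p) powr (r - 1) - r * s powr (r - 1)) / p) (at s)"
      unfolding G_def using s assms
      by (auto intro!: derivative_eq_intros simp: algebra_simps diff_divide_distrib)
    have "\<exists>z. s < z \<and> z < s + p \<and>
        (s + p) powr (r - 1) - s powr (r - 1) = (s + p - s) * ((r - 1) * z powr (r - 1 - 1))"
      using s assms by (intro MVT2) (auto intro!: derivative_eq_intros)
    then obtain z where z: "s < z"
      "(s + p) powr (r - 1) - s powr (r - 1) = p * ((r - 1) * z powr (r - 2))"
      by auto
    have "r * ((1 - r) * z powr (r - 2)) \<le> 1 * ((1 - r) * s powr (r - 2))"
      using s z assms by (intro mult_mono mult_left_mono powr_mono2') auto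
    moreover have "(r * (s + p) powr (r - 1) - r * s powr (r - 1)) / p = r * ((r - 1) * z powr (r - 2))"
      using z(2) assms by (simp flip: right_diff_distrib)
    ultimately have "(r - 1) * s powr (r - 2) - (r * (s + p) powr (r - 1) - r * s powr (r - 1)) / p \<le> 0"
      by (simp add: left_diff_distrib right_diff_distrib)
    with deriv show "\<exists>D. (G has_real_derivative D) (at s) \<and> D \<le> 0"
      by blast
  qed
  then show ?thesis
    using assms by (simp add: G_def powr_diff)
qed

text \<open>
Up to the factor \<open>1 / \<Gamma>(2 - \<alpha>)\<close>, with \<open>r = 1 - \<alpha>\<close>: the Caputo derivative at the collocation point \<open>\<theta> k\<close> of
the piecewise linear interpolant, where only the part of the last interval before \<open>\<theta> k\<close> counts.
Taking \<open>\<theta> k = t (Suc k)\<close> gives the L1 formula, the midpoint of the step gives its half-step version.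
\<close>

definition power_kernel :: "real \<Rightarrow> (nat \<Rightarrow> real) \<Rightarrow> (nat \<Rightarrow> real) \<Rightarrow> nat \<Rightarrow> nat \<Rightarrow> real" where
  "power_kernel r t \<theta> k j =
     ((\<theta> k - t j) powr r - (if j < k then (\<theta> k - t (Suc j)) powr r else 0)) / (t (Suc j) - t j)"

text \<open>
Points in the right half of each step cover both schemes at once. The midpoint is where
\<open>diagonal_ge\<close> becomes an equality: closer to the left end, the diagonal of the kernel degenerates.
\<close>

locale collocated_mesh =
  fixes r :: real and N :: nat and t \<theta> :: "nat \<Rightarrow> real"
  assumes exponent: "0 < r" "r < 1"
    and step: "\<And>k. k < N \<Longrightarrow> t k < t (Suc k)"
    and node: "\<And>k. k < N \<Longrightarrow> (t k + t (Suc k)) / 2 \<le> \<theta> k" "\<And>k. k < N \<Longrightarrow> \<theta> k \<le> t (Suc k)"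
begin

lemma t_less: "t j < t k" if "j < k" "k \<le> N"
  using that
proof (induction k)
  case (Suc k)
  then show ?case using step[of k] by (cases "j = k") (auto intro: less_trans)
qed simp

lemma t_le: "t j \<le> t k" if "j \<le> k" "k \<le> N"
  using that t_less[of j k] by (cases "j = k") auto

lemma t_less_\<theta>: "t j < \<theta> k" if "j \<le> k" "k < N"
  using step[of k] node(1)[of k] t_le[of j k] that by auto

text \<open>
Concavity of the power: recent intervals weigh more than older ones.
\<close>

lemma kernel_row_increasing:
  assumes "Suc j < k" "k < N"
  shows "power_kernel r t \<theta> k j \<le> power_kernel r t \<theta> k (Suc j)"
proof -
  have "((\<theta> k - t j) powr r - (\<theta> k - t (Suc j)) powr r) / (\<theta> k - t j - (\<theta> k - t (Suc j)))
     \<le> ((\<theta> k - t (Suc j)) powr r - (\<theta> k - t (Suc (Suc j))) powr r)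
         / (\<theta> k - t (Suc j) - (\<theta> k - t (Suc (Suc j))))"
    using assms t_less_\<theta>[of "Suc (Suc j)" k] step[of j] step[of "Suc j"] exponent
    by (intro powr_slope_decreasing) auto
  then show ?thesis
    using assms by (simp add: power_kernel_def)
qed

text \<open>
The quotient on the left is the mean of \<open>r s\<^sup>r\<^sup>-\<^sup>1\<close> over \<open>[0, \<theta> k - t k]\<close>; it is what the shape properties of
the power function can be applied to.
\<close>

lemma diagonal_ge:
  assumes "k < N"
  shows "(\<theta> k - t k) powr r / (\<theta> k - t k) \<le> 2 * power_kernel r t \<theta> k k"
proof -
  have "(\<theta> k - t k) powr r * (t (Suc k) - t k) \<le> (\<theta> k - t k) powr r * (2 * (\<theta> k - t k))"
    using node(1)[OF assms] by (intro mult_left_mono) auto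
  then show ?thesis
    using step[OF assms] t_less_\<theta>[of k k] assms by (simp add: power_kernel_def field_simps)
qed

lemma kernel_row_diagonal:
  assumes "Suc j = k" "k < N"
  shows "power_kernel r t \<theta> k j \<le> (\<theta> k - t k) powr r / (\<theta> k - t k)"
proof -
  have "((\<theta> k - t j) powr r - (\<theta> k - t k) powr r) / (\<theta> k - t j - (\<theta> k - t k))
     \<le> ((\<theta> k - t k) powr r - 0 powr r) / (\<theta> k - t k - 0)"
    using assms t_less_\<theta>[of k k] step[of j] exponent
    by (intro powr_slope_decreasing) auto
  then show ?thesis
    using assms by (auto simp: power_kernel_def)
qed

lemma kernel_decreasing_in_time:
  assumes "j < k" "Suc k < N"
  shows "power_kernel r t \<theta> (Suc k) j \<le> power_kernel r t \<theta> k j"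
proof -
  have le: "\<theta> k \<le> \<theta> (Suc k)"
    using node(2)[of k] t_less_\<theta>[of "Suc k" "Suc k"] assms by auto
  have "((\<theta> (Suc k) - t (Suc j)) + (t (Suc j) - t j)) powr r - (\<theta> (Suc k) - t (Suc j)) powr r
     \<le> ((\<theta> k - t (Suc j)) + (t (Suc j) - t j)) powr r - (\<theta> k - t (Suc j)) powr r"
    using assms le step[of j] t_less_\<theta>[of "Suc j" k] exponent
    by (intro powr_increment_antimono) auto
  then show ?thesis
    using assms step[of j] by (auto simp: power_kernel_def intro!: divide_right_mono)
qed

lemma kernel_after_diagonal:
  assumes "Suc k < N"
  shows "power_kernel r t \<theta> (Suc k) k \<le> (t (Suc k) - t k) powr r / (t (Suc k) - t k)"
proof -
  have "((\<theta> (Suc k) - t (Suc k)) + (t (Suc k) - t k)) powr r - (\<theta> (Suc k) - t (Suc k)) powr r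
     \<le> (0 + (t (Suc k) - t k)) powr r - 0 powr r"
    using assms step[of k] t_less_\<theta>[of "Suc k" "Suc k"] exponent
    by (intro powr_increment_antimono) auto
  then show ?thesis
    using assms step[of k] by (auto simp: power_kernel_def intro!: divide_right_mono)
qed

lemma kernel_difference_decreasing:
  assumes "Suc j < k" "Suc k < N"
  shows "power_kernel r t \<theta> (Suc k) (Suc j) - power_kernel r t \<theta> (Suc k) j
       \<le> power_kernel r t \<theta> k (Suc j) - power_kernel r t \<theta> k j"
proof -
  have le: "\<theta> k \<le> \<theta> (Suc k)"
    using node(2)[of k] t_less_\<theta>[of "Suc k" "Suc k"] assms by auto
  define d where "d = \<theta> (Suc k) - \<theta> k"
  let ?x = "\<theta> k - t (Suc (Suc j))" and ?y = "\<theta> k - t (Suc j)" and ?z = "\<theta> k - t j"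
  have "((?y + d) powr r - (?x + d) powr r) / (?y - ?x) - ((?z + d) powr r - (?y + d) powr r) / (?z - ?y)
       \<le> (?y powr r - ?x powr r) / (?y - ?x) - (?z powr r - ?y powr r) / (?z - ?y)"
    using assms le step[of j] step[of "Suc j"] t_less_\<theta>[of "Suc (Suc j)" k] exponent
    by (intro powr_slope_difference_antimono) (auto simp: d_def)
  then show ?thesis
    using assms by (simp add: power_kernel_def d_def)
qed

text \<open>
Row \<open>Suc k\<close> is first moved back in time, with \<open>\<theta> (Suc k)\<close> replaced by \<open>t (Suc k)\<close>, by convexity of the
derivative of the power; the result is the diagonal excess for a full step, which is at most
that for \<open>\<theta> k - t k\<close>.
\<close>

lemma kernel_difference_after_diagonal:
  assumes "Suc j = k" "Suc k < N"
  shows "power_kernel r t \<theta> (Suc k) k - power_kernel r t \<theta> (Suc k) j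
       \<le> (\<theta> k - t k) powr r / (\<theta> k - t k) - power_kernel r t \<theta> k j"
proof -
  define \<tau> where "\<tau> = t (Suc k) - t k"
  define p where "p = t k - t j"
  define d where "d = \<theta> (Suc k) - t (Suc k)"
  have pos: "0 < \<tau>" "0 < p" "0 \<le> d"
    using step[of k] step[of j] assms t_less_\<theta>[of "Suc k" "Suc k"]
    by (auto simp: \<tau>_def p_def d_def)
  have "power_kernel r t \<theta> (Suc k) k - power_kernel r t \<theta> (Suc k) j
      = ((\<tau> + d) powr r - (0 + d) powr r) / (\<tau> - 0)
        - ((\<tau> + p + d) powr r - (\<tau> + d) powr r) / (\<tau> + p - \<tau>)"
    using assms by (auto simp: power_kernel_def \<tau>_def p_def d_def algebra_simps)
  also have "\<dots> \<le> (\<tau> powr r - 0 powr r) / (\<tau> - 0) - ((\<tau> + p) powr r - \<tau> powr r) / (\<tau> + p - \<tau>)"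
    using pos exponent by (intro powr_slope_difference_antimono) auto
  also have "\<dots> = \<tau> powr r / \<tau> - ((\<tau> + p) powr r - \<tau> powr r) / p"
    by simp
  also have "\<dots> \<le> (\<theta> k - t k) powr r / (\<theta> k - t k)
      - ((\<theta> k - t k + p) powr r - (\<theta> k - t k) powr r) / p"
    using pos exponent node(2)[of k] assms t_less_\<theta>[of k k]
    by (intro powr_diagonal_excess_antimono) (auto simp: \<tau>_def)
  also have "\<dots> = (\<theta> k - t k) powr r / (\<theta> k - t k) - power_kernel r t \<theta> k j"
    using assms by (auto simp: power_kernel_def p_def)
  finally show ?thesis .
qed

lemma power_kernel_nonneg:
  assumes "j \<le> k" "k < N"
  shows "0 \<le> power_kernel r t \<theta> k j"
  using assms step[of j] t_less_\<theta>[of "Suc j" k] exponent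
  by (auto simp: power_kernel_def intro!: divide_nonneg_nonneg powr_mono2)

lemma dissipative_power_kernel: "dissipative_kernel N (power_kernel r t \<theta>)"
  unfolding dissipative_kernel_def
proof (intro conjI allI impI)
  fix k assume k: "k < N"
  show "0 < power_kernel r t \<theta> k k"
    using step[OF k] t_less_\<theta>[of k k] k by (simp add: power_kernel_def)
next
  fix k j assume *: "k < N" "j \<le> k"
  show "0 \<le> row_weight (power_kernel r t \<theta>) k j"
  proof (cases j)
    case 0
    then show ?thesis
      using power_kernel_nonneg[of 0 k] power_kernel_nonneg[of k k] * by (auto simp: row_weight_def backward_diff_def)
  next
    case (Suc i)
    consider "j < k" | "j = k" using * by linarith
    then show ?thesis
    proof cases
      case 1
      then show ?thesis
        using kernel_row_increasing[of i k] * Suc by (simp add: row_weight_def backward_diff_def)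
    next
      case 2
      then show ?thesis
        using kernel_row_diagonal[of i k] diagonal_ge[of k] * Suc
        by (auto simp: row_weight_def backward_diff_def)
    qed
  qed
next
  fix k j assume *: "Suc k < N" "j \<le> k"
  show "backward_diff (power_kernel r t \<theta> (Suc k)) j \<le> row_weight (power_kernel r t \<theta>) k j"
  proof (cases j)
    case 0
    show ?thesis
    proof (cases "k = 0")
      case True
      \<comment> \<open>In the first row there is no left neighbour, and \<open>\<theta> 0 \<le> t 1\<close> is all that is needed.\<close>
      have "(t (Suc 0) - t 0) powr (r - 1) \<le> (\<theta> 0 - t 0) powr (r - 1)"
        using * True node(2)[of 0] t_less_\<theta>[of 0 0] exponent by (intro powr_mono2') auto
      then show ?thesis
        using kernel_after_diagonal[of k] diagonal_ge[of k] * True 0 step[of 0] t_less_\<theta>[of 0 0]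
        by (simp add: row_weight_def backward_diff_def powr_diff)
    next
      case False
      then show ?thesis
        using kernel_decreasing_in_time[of 0 k] * 0 by (simp add: row_weight_def backward_diff_def)
    qed
  next
    case (Suc i)
    consider "j < k" | "j = k" using * by linarith
    then show ?thesis
    proof cases
      case 1
      then show ?thesis
        using kernel_difference_decreasing[of i k] * Suc by (simp add: row_weight_def backward_diff_def)
    next
      case 2
      then show ?thesis
        using kernel_difference_after_diagonal[of i k] diagonal_ge[of k] * Suc
        by (auto simp: row_weight_def backward_diff_def)
    qed
  qed
qed

end

lemma collocated_mesh_right:
  assumes "0 < \<alpha>" "\<alpha> < 1" "time_mesh T N t"
  shows "collocated_mesh (1 - \<alpha>) N t (\<lambda>k. t (Suc k))"
  using assms by unfold_locales (auto simp: time_mesh_def intro: less_imp_le)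

lemma collocated_mesh_midpoint:
  assumes "0 < \<alpha>" "\<alpha> < 1" "time_mesh T N t"
  shows "collocated_mesh (1 - \<alpha>) N t (\<lambda>k. (t k + t (Suc k)) / 2)"
  using assms by unfold_locales (auto simp: time_mesh_def intro: less_imp_le)

lemma L1_deriv_eq_power_kernel:
  "L1_deriv \<alpha> t \<phi> (Suc n) x
     = (\<Sum>j\<le>n. 1 / Gamma (2 - \<alpha>) * power_kernel (1 - \<alpha>) t (\<lambda>k. t (Suc k)) n j * (\<phi> (Suc j) x - \<phi> j x))"
proof -
  have "L1_deriv \<alpha> t \<phi> (Suc n) x = (\<Sum>j\<le>n. L1_coeff \<alpha> t (Suc n) (Suc j) * (\<phi> (Suc j) x - \<phi> j x))"
    unfolding L1_deriv_def One_nat_def sum.atLeast_Suc_atMost_Suc_shift atMost_atLeast0 by simp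
  also have "\<dots> = (\<Sum>j\<le>n. 1 / Gamma (2 - \<alpha>) * power_kernel (1 - \<alpha>) t (\<lambda>k. t (Suc k)) n j * (\<phi> (Suc j) x - \<phi> j x))"
    by (intro sum.cong) (auto simp: L1_coeff_def power_kernel_def le_less)
  finally show ?thesis .
qed

lemma L1_half_deriv_eq_power_kernel:
  assumes "0 < \<alpha>" "\<alpha> < 1" "time_mesh T N t" "n < N"
  shows "L1_half_deriv \<alpha> t \<phi> n x
     = (\<Sum>j\<le>n. 1 / Gamma (2 - \<alpha>) * power_kernel (1 - \<alpha>) t (\<lambda>k. (t k + t (Suc k)) / 2) n j * (\<phi> (Suc j) x - \<phi> j x))"
proof -
  interpret collocated_mesh "1 - \<alpha>" N t "\<lambda>k. (t k + t (Suc k)) / 2"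
    using assms(1-3) by (rule collocated_mesh_midpoint)
  \<comment> \<open>The half-step coefficients are written with doubled arguments; the factor \<open>2 powr (1 - \<alpha>)\<close> undoes this.\<close>
  have double: "(t (n + 1) + t n - 2 * t j) powr (1 - \<alpha>)
      = 2 powr (1 - \<alpha>) * ((t n + t (Suc n)) / 2 - t j) powr (1 - \<alpha>)" if "j \<le> n" for j
  proof -
    have "t (n + 1) + t n - 2 * t j = 2 * ((t n + t (Suc n)) / 2 - t j)" by simp
    then show ?thesis
      using t_less_\<theta>[OF that assms(4)] by (simp only: powr_mult)
  qed
  have "L1_half_coeff \<alpha> t n j = 1 / Gamma (2 - \<alpha>) * power_kernel (1 - \<alpha>) t (\<lambda>k. (t k + t (Suc k)) / 2) n j"
    if "j \<le> n" for j
  proof (cases "j < n")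
    case True
    then show ?thesis
      using double[of j] double[of "Suc j"]
      by (simp add: L1_half_coeff_def power_kernel_def flip: right_diff_distrib)
  next
    case False
    then have "j = n" using that by simp
    then show ?thesis
      using double[of n] by (simp add: L1_half_coeff_def power_kernel_def)
  qed
  then show ?thesis
    unfolding L1_half_deriv_def atMost_atLeast0 by (intro sum.cong) auto
qed

text \<open>
This isolates the newest value, so that the L1 derivative reads as that value minus a combination
of the earlier ones; this is the form needed for a maximum principle.
\<close>

lemma sum_increment_by_parts:
  fixes c w :: "nat \<Rightarrow> real"
  shows "(\<Sum>j\<le>n. c j * (w (Suc j) - w j)) = c n * w (Suc n) - (\<Sum>j\<le>n. backward_diff c j * w j)"
  by (induction n) (simp_all add: backward_diff_def algebra_simps)

text \<open>
At the right end of the step the diagonal entry itself, and not just its double, dominates its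
left neighbour.
\<close>

lemma backward_diff_kernel_right_nonneg:
  assumes "collocated_mesh r N t (\<lambda>k. t (Suc k))" "k < N" "j \<le> k"
  shows "0 \<le> backward_diff (power_kernel r t (\<lambda>k. t (Suc k)) k) j"
proof -
  interpret collocated_mesh r N t "\<lambda>k. t (Suc k)" by fact
  show ?thesis
  proof (cases j)
    case 0
    then show ?thesis
      using power_kernel_nonneg[of 0 k] assms by (simp add: backward_diff_def)
  next
    case (Suc i)
    consider "Suc i < k" | "Suc i = k" using assms Suc by linarith
    then show ?thesis
    proof cases
      case 1
      then show ?thesis
        using kernel_row_increasing[of i k] assms Suc by (simp add: backward_diff_def)
    next
      case 2
      have "power_kernel r t (\<lambda>k. t (Suc k)) k k = (t (Suc k) - t k) powr r / (t (Suc k) - t k)"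
        by (simp add: power_kernel_def)
      then show ?thesis
        using kernel_row_diagonal[OF 2 assms(2)] 2 Suc by (auto simp: backward_diff_def)
    qed
  qed
qed

section \<open>Functions with continuous partial derivatives\<close>

lemma partial_eqI: "(u has_derivative D) (at x) \<Longrightarrow> partial i u x = D i"
  by (simp add: partial_def flip: frechet_derivative_at)

lemma Ck_Suc_differentiable: "Ck (Suc k) u \<Longrightarrow> u differentiable (at x)"
  by simp

lemma Ck_Suc_has_derivative:
  "Ck (Suc k) u \<Longrightarrow> (u has_derivative frechet_derivative u (at x)) (at x)"
  using Ck_Suc_differentiable frechet_derivative_works by blast

lemma Ck_Suc_imp_Ck: "Ck (Suc k) u \<Longrightarrow> Ck k u"
proof (induction k arbitrary: u)
  case 0
  then show ?case
    by (auto simp: continuous_on_eq_continuous_at intro: differentiable_imp_continuous_within)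
next
  case (Suc k)
  then show ?case by (metis Ck.simps(2))
qed

lemma Ck_continuous: "Ck k u \<Longrightarrow> continuous_on UNIV u"
  by (induction k) (auto dest: Ck_Suc_imp_Ck simp del: Ck.simps(2))

lemma Ck_2_imp_1: "Ck 2 u \<Longrightarrow> Ck 1 u"
  using Ck_Suc_imp_Ck[of 1 u] by (simp add: numeral_2_eq_2)

lemma Ck_2_partial: "Ck 2 u \<Longrightarrow> i \<in> Basis \<Longrightarrow> Ck 1 (partial i u)"
  by (simp add: numeral_2_eq_2)

lemma Ck_1_partial: "Ck 1 u \<Longrightarrow> i \<in> Basis \<Longrightarrow> continuous_on UNIV (partial i u)"
  by simp

lemma Ck_1_has_derivative: "Ck 1 u \<Longrightarrow> (u has_derivative frechet_derivative u (at x)) (at x)"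
  using Ck_Suc_has_derivative[of 0] by simp

lemma Ck_1_differentiable: "Ck 1 u \<Longrightarrow> u differentiable (at x)"
  by simp

lemma Ck_1I:
  assumes "\<And>x. (u has_derivative D x) (at x)"
    and "\<And>i. i \<in> Basis \<Longrightarrow> continuous_on UNIV (\<lambda>x. D x i)"
  shows "Ck 1 u"
proof -
  have "partial i u = (\<lambda>x. D x i)" for i
    using partial_eqI[OF assms(1)] by blast
  then show ?thesis
    using assms by (auto simp: differentiable_def)
qed

lemma partial_linear:
  assumes "u differentiable (at x)" "v differentiable (at x)"
  shows "partial i (\<lambda>x. c * u x + d * v x) x = c * partial i u x + d * partial i v x"
proof -
  have "((\<lambda>x. c * u x + d * v x) has_derivative
      (\<lambda>h. c * frechet_derivative u (at x) h + d * frechet_derivative v (at x) h)) (at x)"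
    using assms by (auto intro!: derivative_eq_intros simp: frechet_derivative_works)
  from partial_eqI[OF this] show ?thesis
    by (simp add: partial_def)
qed

lemma Ck_linear:
  "Ck k u \<Longrightarrow> Ck k v \<Longrightarrow> Ck k (\<lambda>x. c * u x + d * v x)"
proof (induction k arbitrary: u v)
  case (Suc k)
  then have "partial i (\<lambda>x. c * u x + d * v x) = (\<lambda>x. c * partial i u x + d * partial i v x)" for i
    by (auto simp: partial_linear)
  then show ?case
    using Suc by auto
qed (auto intro!: continuous_intros)

lemma Ck_const: "Ck k (\<lambda>x::'a::euclidean_space. c)"
proof (induction k arbitrary: c)
  case (Suc k)
  have "partial i (\<lambda>x::'a. c) = (\<lambda>x. 0)" for i
    using partial_eqI[OF has_derivative_const] by blast
  then show ?case using Suc by simp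
qed simp

lemma Ck_1_mult:
  fixes u v :: "'a::euclidean_space \<Rightarrow> real"
  assumes "Ck 1 u" "Ck 1 v"
  shows "Ck 1 (\<lambda>x. u x * v x)"
    and "partial i (\<lambda>x. u x * v x) x = u x * partial i v x + partial i u x * v x"
proof -
  have deriv: "((\<lambda>x. u x * v x) has_derivative
      (\<lambda>h. u x * frechet_derivative v (at x) h + frechet_derivative u (at x) h * v x)) (at x)" for x
    using assms Ck_1_has_derivative by (intro has_derivative_mult) blast+
  then show "partial i (\<lambda>x. u x * v x) x = u x * partial i v x + partial i u x * v x"
    using partial_eqI[OF deriv] by (simp add: partial_def)
  show "Ck 1 (\<lambda>x. u x * v x)"
  proof (rule Ck_1I[OF deriv])
    fix i :: 'a assume "i \<in> Basis"
    then show "continuous_on UNIV (\<lambda>x. u x * frechet_derivative v (at x) i + frechet_derivative u (at x) i * v x)"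
      using assms Ck_1_partial[of _ i] Ck_continuous[of 1] unfolding partial_def
      by (intro continuous_intros) blast+
  qed
qed

lemma laplacian_linear:
  assumes "Ck 2 u" "Ck 2 v"
  shows "laplacian (\<lambda>x. c * u x + d * v x) x = c * laplacian u x + d * laplacian v x"
proof -
  have "partial i (partial i (\<lambda>x. c * u x + d * v x)) x
      = c * partial i (partial i u) x + d * partial i (partial i v) x" if "i \<in> Basis" for i
  proof -
    have "partial i (\<lambda>x. c * u x + d * v x) = (\<lambda>x. c * partial i u x + d * partial i v x)"
      using assms by (auto simp: partial_linear numeral_2_eq_2)
    then show ?thesis
      using assms that by (simp add: partial_linear numeral_2_eq_2)
  qed
  then show ?thesis
    by (simp add: laplacian_def sum.distrib sum_distrib_left)
qed

lemma Ck_2_laplacian_continuous: "Ck 2 u \<Longrightarrow> continuous_on UNIV (laplacian u)"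
  unfolding laplacian_def by (intro continuous_on_sum) (simp add: numeral_2_eq_2)

text \<open>
Reduces questions about partial derivatives to functions of one real variable.
\<close>

lemma partial_along_line:
  assumes "\<And>x. u differentiable (at x)"
  shows "((\<lambda>h. u (x + h *\<^sub>R i)) has_real_derivative partial i u (x + h *\<^sub>R i)) (at h within S)"
proof -
  have "((\<lambda>h. x + h *\<^sub>R i) has_derivative (\<lambda>h. h *\<^sub>R i)) (at h within S)"
    by (auto intro!: derivative_eq_intros)
  moreover have "(u has_derivative frechet_derivative u (at (x + h *\<^sub>R i))) (at (x + h *\<^sub>R i))"
    using assms frechet_derivative_works by blast
  ultimately have "((\<lambda>h. u (x + h *\<^sub>R i)) has_derivative
      (\<lambda>k. frechet_derivative u (at (x + h *\<^sub>R i)) (k *\<^sub>R i))) (at h within S)"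
    by (rule has_derivative_compose)
  moreover have "(\<lambda>k. frechet_derivative u (at (x + h *\<^sub>R i)) (k *\<^sub>R i)) = (*) (partial i u (x + h *\<^sub>R i))"
    using linear_cmul[OF linear_frechet_derivative[OF assms]] by (simp add: partial_def mult.commute fun_eq_iff)
  ultimately show ?thesis
    by (simp add: has_field_derivative_def)
qed

text \<open>
If a second derivative in a basis direction were positive at a global maximum, the first derivative along that
direction, which vanishes there, would be positive just after it, and the function would grow.
\<close>

lemma laplacian_nonpos_at_maximum:
  fixes u :: "'a::euclidean_space \<Rightarrow> real"
  assumes "Ck 2 u" and max: "\<And>y. u y \<le> u x"
  shows "laplacian u x \<le> 0"
  unfolding laplacian_def
proof (rule sum_nonpos)
  fix i :: 'a assume i: "i \<in> Basis"
  define g where "g h = u (x + h *\<^sub>R i)" for h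
  define g' where "g' h = partial i u (x + h *\<^sub>R i)" for h
  have d1: "(g has_real_derivative g' h) (at h)" for h
    unfolding g_def g'_def using assms(1) by (intro partial_along_line) (simp add: numeral_2_eq_2)
  have d2: "(g' has_real_derivative partial i (partial i u) x) (at 0)"
    unfolding g'_def
    using partial_along_line[of "partial i u" x i 0 UNIV] assms(1) i by (simp add: numeral_2_eq_2)
  have "g' 0 = 0"
  proof (rule DERIV_local_max[OF d1])
    show "\<forall>y. \<bar>0 - y\<bar> < 1 \<longrightarrow> g y \<le> g 0"
      using max by (simp add: g_def)
  qed simp
  show "partial i (partial i u) x \<le> 0"
  proof (rule ccontr)
    assume "\<not> partial i (partial i u) x \<le> 0"
    then obtain e where e: "0 < e" "\<And>h. 0 < h \<Longrightarrow> h < e \<Longrightarrow> g' 0 < g' (0 + h)"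
      using DERIV_pos_inc_right[OF d2] by auto
    have "\<exists>z. 0 < z \<and> z < e / 2 \<and> g (e / 2) - g 0 = (e / 2 - 0) * g' z"
      using e d1 by (intro MVT2) auto
    then obtain z where z: "0 < z" "z < e / 2" "g (e / 2) - g 0 = e / 2 * g' z" by auto
    have "0 < g' z" using e(2)[of z] z(1,2) e(1) \<open>g' 0 = 0\<close> by simp
    then have "0 < e / 2 * g' z" using e(1) by simp
    then have "g 0 < g (e / 2)" using z(3) by linarith
    then show False using max[of "x + (e / 2) *\<^sub>R i"] by (simp add: g_def)
  qed
qed

lemma Ck_sum:
  assumes "finite A" "\<And>j. j \<in> A \<Longrightarrow> Ck k (u j)"
  shows "Ck k (\<lambda>x. \<Sum>j\<in>A. c j * u j x)"
  using assms
proof (induction A rule: finite_induct)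
  case (insert i A)
  then show ?case
    using Ck_linear[of k "u i" "\<lambda>x. \<Sum>j\<in>A. c j * u j x" "c i" 1] by simp
qed (simp add: Ck_const)

lemma partial_sum:
  assumes "finite A" "\<And>j. j \<in> A \<Longrightarrow> Ck 1 (u j)"
  shows "partial i (\<lambda>x. \<Sum>j\<in>A. c j * u j x) x = (\<Sum>j\<in>A. c j * partial i (u j) x)"
proof -
  have "((\<lambda>x. \<Sum>j\<in>A. c j * u j x) has_derivative
      (\<lambda>h. \<Sum>j\<in>A. c j * frechet_derivative (u j) (at x) h)) (at x)"
    using assms(2) Ck_1_has_derivative
    by (intro has_derivative_sum has_derivative_mult_right) blast
  then show ?thesis
    using partial_eqI by (fastforce simp: partial_def)
qed

lemma laplacian_sum:
  assumes "finite A" "\<And>j. j \<in> A \<Longrightarrow> Ck 2 (u j)"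
  shows "laplacian (\<lambda>x. \<Sum>j\<in>A. c j * u j x) x = (\<Sum>j\<in>A. c j * laplacian (u j) x)"
  using assms
proof (induction A rule: finite_induct)
  case empty
  show ?case
    using laplacian_linear[of "\<lambda>x. 0" "\<lambda>x. 0" 0 0 x] by (simp add: Ck_const)
next
  case (insert i A)
  have "Ck 2 (u i)" "Ck 2 (\<lambda>x. \<Sum>j\<in>A. c j * u j x)"
    using insert.prems insert.hyps(1) by (auto intro: Ck_sum)
  then have "laplacian (\<lambda>x. c i * u i x + 1 * (\<Sum>j\<in>A. c j * u j x)) x
      = c i * laplacian (u i) x + 1 * laplacian (\<lambda>x. \<Sum>j\<in>A. c j * u j x) x"
    by (rule laplacian_linear)
  also have "laplacian (\<lambda>x. \<Sum>j\<in>A. c j * u j x) x = (\<Sum>j\<in>A. c j * laplacian (u j) x)"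
    using insert.prems by (intro insert.IH) auto
  finally show ?case
    using insert.hyps by simp
qed

lemma grad_inner: "i \<in> Basis \<Longrightarrow> grad u x \<bullet> i = partial i u x"
  by (simp add: grad_def)

lemma grad_continuous: "Ck 1 u \<Longrightarrow> continuous_on UNIV (grad u)"
  unfolding grad_def by (intro continuous_on_sum continuous_intros Ck_1_partial) auto

lemma Ck_1_inverse:
  assumes "Ck 1 w" "\<And>x. 0 < w x"
  shows "Ck 1 (\<lambda>x. inverse (w x))"
proof (rule Ck_1I)
  fix x
  have "w x \<noteq> 0" using assms(2)[of x] by simp
  then show "((\<lambda>x. inverse (w x)) has_derivative
      (\<lambda>h. - (inverse (w x) * frechet_derivative w (at x) h * inverse (w x)))) (at x)"
    using Ck_1_has_derivative[OF assms(1)] by (intro Deriv.has_derivative_inverse)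
next
  fix i :: 'a assume "i \<in> Basis"
  then have "continuous_on UNIV (partial i w)"
    using assms(1) by (intro Ck_1_partial)
  moreover have "\<forall>x\<in>UNIV. w x \<noteq> 0"
    using assms(2) by (simp add: less_imp_neq[symmetric])
  ultimately show "continuous_on UNIV (\<lambda>x. - (inverse (w x) * frechet_derivative w (at x) i * inverse (w x)))"
    using Ck_continuous[OF assms(1)] unfolding partial_def by (intro continuous_intros) auto
qed

text \<open>
The flux of the MBE model without slope selection is regular enough for the divergence theorem.
\<close>

lemma Ck_1_normalized_gradient:
  assumes "Ck 2 u" "i \<in> Basis"
  shows "Ck 1 (\<lambda>x. (grad u x /\<^sub>R (1 + (norm (grad u x))\<^sup>2)) \<bullet> i)"
proof -
  have sq: "(norm (grad u x))\<^sup>2 = (\<Sum>j\<in>Basis. 1 * (partial j u x * partial j u x))" for x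
    unfolding power2_norm_eq_inner euclidean_inner[of "grad u x" "grad u x"]
    by (intro sum.cong) (auto simp: grad_inner)
  have "Ck 1 (\<lambda>x. 1 * (1::real) + 1 * (norm (grad u x))\<^sup>2)"
    unfolding sq by (intro Ck_linear Ck_const Ck_sum Ck_1_mult Ck_2_partial assms(1)) auto
  then have "Ck 1 (\<lambda>x. inverse (1 * 1 + 1 * (norm (grad u x))\<^sup>2))"
    by (rule Ck_1_inverse) (simp add: add_pos_nonneg)
  from Ck_1_mult(1)[OF this Ck_2_partial[OF assms]] show ?thesis
    using assms(2) by (simp add: grad_inner)
qed

section \<open>Integration by parts on a periodic box\<close>

\<comment> \<open>From here on regularity is handled through the lemmas above; unfolded, they would no longer apply.\<close>
declare Ck.simps(2) [simp del]

lemma periodic_on_box_partial: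
  assumes "periodic_on_box a b u"
  shows "periodic_on_box a b (partial i u)"
  unfolding periodic_on_box_def
proof (intro allI ballI)
  fix x j :: 'a assume j: "j \<in> Basis"
  define c where "c = ((b - a) \<bullet> j) *\<^sub>R j"
  have shift: "u (y + c) = u y" for y
    using assms j by (simp add: periodic_on_box_def c_def)
  have transport: "(u has_derivative D) (at w)"
    if "(u has_derivative D) (at (w + e))" "\<And>y. u (y + e) = u y" for D w e
  proof -
    have "((\<lambda>y. y + e) has_derivative (\<lambda>h. h)) (at w)"
      by (auto intro!: derivative_eq_intros)
    from has_derivative_compose[OF this that(1)] show ?thesis
      by (simp add: that(2))
  qed
  have "u (y - c) = u y" for y
    using shift[of "y - c"] by simp
  then have "(u has_derivative D) (at (x + c)) \<longleftrightarrow> (u has_derivative D) (at x)" for D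
    using transport[of D x c] transport[of D "x + c" "- c"] shift by auto
  then show "partial i u (x + ((b - a) \<bullet> j) *\<^sub>R j) = partial i u x"
    by (simp add: partial_def frechet_derivative_def c_def)
qed

lemma periodic_on_box_laplacian:
  assumes "periodic_on_box a b u"
  shows "periodic_on_box a b (laplacian u)"
proof -
  have "\<forall>i. periodic_on_box a b (partial i (partial i u))"
    by (intro allI periodic_on_box_partial assms)
  then show ?thesis
    by (simp add: periodic_on_box_def laplacian_def)
qed

locale periodic_box =
  fixes a b :: "'a::euclidean_space"
  assumes box_nondegenerate: "\<And>i. i \<in> Basis \<Longrightarrow> a \<bullet> i < b \<bullet> i"
begin

lemma continuous_integrable:
  fixes u :: "'a \<Rightarrow> real"
  shows "continuous_on UNIV u \<Longrightarrow> u integrable_on cbox a b"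
  by (intro integrable_continuous) (auto intro: continuous_on_subset)

text \<open>
The box is cut perpendicular to \<open>i\<close>, with the two pieces written as boxes again so that they can be
translated.
\<close>

lemma integral_split_slab:
  fixes w :: "'a \<Rightarrow> real"
  assumes "continuous_on UNIV w" "i \<in> Basis" "0 \<le> s" "s \<le> (b - a) \<bullet> i"
  shows "integral (cbox a b) w
       = integral (cbox a (b - ((b - a) \<bullet> i - s) *\<^sub>R i)) w + integral (cbox (a + s *\<^sub>R i) b) w"
proof -
  have left: "cbox a b \<inter> {x. x \<bullet> i \<le> a \<bullet> i + s} = cbox a (b - ((b - a) \<bullet> i - s) *\<^sub>R i)"
    using assms
    by (auto simp: mem_box inner_diff_left inner_Basis algebra_simps split: if_splits)
      (metis add.commute order_trans)
  have right: "cbox a b \<inter> {x. x \<bullet> i \<ge> a \<bullet> i + s} = cbox (a + s *\<^sub>R i) b"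
    using assms
    by (auto simp: mem_box inner_diff_left inner_add_left inner_Basis split: if_splits)
      (metis le_add_same_cancel1 order_trans)
  have "integral (cbox a b) w = integral (cbox a b \<inter> {x. x \<bullet> i \<le> a \<bullet> i + s}) w
      + integral (cbox a b \<inter> {x. x \<bullet> i \<ge> a \<bullet> i + s}) w"
  proof (rule integral_unique, rule has_integral_split[OF _ _ assms(2)])
    show "(w has_integral integral (cbox a b \<inter> {x. x \<bullet> i \<le> a \<bullet> i + s}) w)
        (cbox a b \<inter> {x. x \<bullet> i \<le> a \<bullet> i + s})"
      unfolding left using assms(1)
      by (intro integrable_integral integrable_continuous) (auto intro: continuous_on_subset)
    show "(w has_integral integral (cbox a b \<inter> {x. x \<bullet> i \<ge> a \<bullet> i + s}) w)
        (cbox a b \<inter> {x. x \<bullet> i \<ge> a \<bullet> i + s})"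
      unfolding right using assms(1)
      by (intro integrable_integral integrable_continuous) (auto intro: continuous_on_subset)
  qed
  then show ?thesis by (simp add: left right)
qed

text \<open>
The part of the shifted box that sticks out on one side is, up to a full period, the part that is
missing on the other side.
\<close>

lemma integral_periodic_shift:
  assumes "continuous_on UNIV w" "periodic_on_box a b w" "i \<in> Basis"
    and h: "0 \<le> h" "h \<le> (b - a) \<bullet> i"
  shows "integral (cbox a b) (\<lambda>x. w (x + h *\<^sub>R i)) = integral (cbox a b) w"
proof -
  define L where "L = (b - a) \<bullet> i"
  have cont: "continuous_on UNIV (\<lambda>x. w (x + h *\<^sub>R i))"
    by (rule continuous_on_compose2[OF assms(1)]) (auto intro!: continuous_intros)
  have wrap: "w (x + h *\<^sub>R i) = w (x + (h - L) *\<^sub>R i)" for x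
  proof -
    have "w (x + (h - L) *\<^sub>R i + L *\<^sub>R i) = w (x + (h - L) *\<^sub>R i)"
      using assms(2,3) by (simp add: periodic_on_box_def L_def)
    then show ?thesis by (simp add: algebra_simps)
  qed
  have "integral (cbox a b) (\<lambda>x. w (x + h *\<^sub>R i))
      = integral (cbox a (b - h *\<^sub>R i)) (\<lambda>x. w (x + h *\<^sub>R i))
        + integral (cbox (a + (L - h) *\<^sub>R i) b) (\<lambda>x. w (x + h *\<^sub>R i))"
    using integral_split_slab[OF cont assms(3), of "L - h"] h by (simp add: L_def)
  also have "integral (cbox a (b - h *\<^sub>R i)) (\<lambda>x. w (x + h *\<^sub>R i)) = integral (cbox (a + h *\<^sub>R i) b) w"
    using integral_shift_cbox[of "a + h *\<^sub>R i" "h *\<^sub>R i" b w] by simp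
  also have "integral (cbox (a + (L - h) *\<^sub>R i) b) (\<lambda>x. w (x + h *\<^sub>R i))
      = integral (cbox a (b - (L - h) *\<^sub>R i)) w"
    using integral_shift_cbox[of a "(h - L) *\<^sub>R i" "b - (L - h) *\<^sub>R i" w]
    by (simp add: wrap scaleR_left_diff_distrib algebra_simps)
  also have "integral (cbox (a + h *\<^sub>R i) b) w + integral (cbox a (b - (L - h) *\<^sub>R i)) w
      = integral (cbox a b) w"
    using integral_split_slab[OF assms(1,3), of h] h by (simp add: L_def)
  finally show ?thesis .
qed

text \<open>
The integral of \<open>x \<mapsto> w (x + h i)\<close> does not depend on \<open>h\<close>, so its derivative at \<open>h = 0\<close>, computed under the
integral sign, is zero. Shifts in one direction suffice, hence the one-sided derivative.
\<close>

lemma integral_partial_periodic: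
  assumes "Ck 1 w" "periodic_on_box a b w" "i \<in> Basis"
  shows "integral (cbox a b) (partial i w) = 0"
proof -
  define L where "L = (b - a) \<bullet> i"
  have L: "0 < L"
    using box_nondegenerate[OF assms(3)] by (simp add: L_def inner_diff_left)
  define J where "J h = integral (cbox a b) (\<lambda>x. w (x + h *\<^sub>R i))" for h
  have "(J has_real_derivative integral (cbox a b) (\<lambda>x. partial i w (x + 0 *\<^sub>R i))) (at 0 within {0..L})"
    unfolding J_def
  proof (rule leibniz_rule_field_derivative[where fx = "\<lambda>h x. partial i w (x + h *\<^sub>R i)"])
    show "((\<lambda>h. w (x + h *\<^sub>R i)) has_real_derivative partial i w (x + h *\<^sub>R i)) (at h within {0..L})" for h x
      using assms(1) by (intro partial_along_line Ck_1_differentiable)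
    show "(\<lambda>x. w (x + h *\<^sub>R i)) integrable_on cbox a b" for h
      by (intro continuous_integrable continuous_on_compose2[OF Ck_continuous[OF assms(1)]])
        (auto intro!: continuous_intros)
    show "continuous_on ({0..L} \<times> cbox a b) (\<lambda>(h, x). partial i w (x + h *\<^sub>R i))"
      unfolding case_prod_beta
      by (rule continuous_on_compose2[OF Ck_1_partial[OF assms(1,3)]]) (auto intro!: continuous_intros)
  qed (use L in auto)
  moreover have "(J has_real_derivative 0) (at 0 within {0..L})"
  proof (rule has_field_derivative_transform_within[where d = 1 and f = "\<lambda>_. J 0"])
    show "J 0 = J h" if "h \<in> {0..L}" for h
      using integral_periodic_shift[OF Ck_continuous[OF assms(1)] assms(2,3), of h] that
      by (simp add: J_def L_def)
  qed (use L in auto)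
  ultimately show ?thesis
    using L by (auto intro!: vector_derivative_unique_within[where f = J and x = 0 and S = "{0..L}"]
        simp: has_real_derivative_iff_has_vector_derivative trivial_limit_within islimpt_Icc)
qed

lemma integration_by_parts_periodic:
  assumes "Ck 1 u" "Ck 1 v" "periodic_on_box a b u" "periodic_on_box a b v" "i \<in> Basis"
  shows "L2_inner a b u (partial i v) = - L2_inner a b (partial i u) v"
proof -
  have "0 = integral (cbox a b) (partial i (\<lambda>x. u x * v x))"
    using assms by (intro integral_partial_periodic[symmetric] Ck_1_mult) (auto simp: periodic_on_box_def)
  also have "partial i (\<lambda>x. u x * v x) = (\<lambda>x. u x * partial i v x + partial i u x * v x)"
    using Ck_1_mult(2)[OF assms(1,2)] by blast
  also have "integral (cbox a b) (\<lambda>x. u x * partial i v x + partial i u x * v x)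
      = L2_inner a b u (partial i v) + L2_inner a b (partial i u) v"
    unfolding L2_inner_def using assms Ck_1_partial[of _ i] Ck_continuous[of 1]
    by (intro integral_add continuous_integrable continuous_intros) blast+
  finally show ?thesis by simp
qed

lemma L2_inner_commute: "L2_inner a b u v = L2_inner a b v u"
  by (simp add: L2_inner_def mult.commute)

lemma L2_inner_linear_right:
  assumes "continuous_on UNIV u" "continuous_on UNIV v" "continuous_on UNIV w"
  shows "L2_inner a b u (\<lambda>x. c * v x + d * w x) = c * L2_inner a b u v + d * L2_inner a b u w"
proof -
  have "L2_inner a b u (\<lambda>x. c * v x + d * w x) = integral (cbox a b) (\<lambda>x. c * (u x * v x) + d * (u x * w x))"
    unfolding L2_inner_def by (intro arg_cong[where f = "integral _"]) (simp add: fun_eq_iff algebra_simps)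
  also have "\<dots> = integral (cbox a b) (\<lambda>x. c * (u x * v x)) + integral (cbox a b) (\<lambda>x. d * (u x * w x))"
    using assms by (intro integral_add continuous_integrable continuous_intros) blast+
  finally show ?thesis by (simp add: L2_inner_def)
qed

lemma L2_inner_sum_right:
  assumes "continuous_on UNIV u" "finite A" "\<And>i. i \<in> A \<Longrightarrow> continuous_on UNIV (v i)"
  shows "L2_inner a b u (\<lambda>x. \<Sum>i\<in>A. v i x) = (\<Sum>i\<in>A. L2_inner a b u (v i))"
  unfolding L2_inner_def sum_distrib_left
  using assms by (intro integral_sum continuous_integrable continuous_intros) blast+

lemma integral_mono_continuous:
  fixes u v :: "'a \<Rightarrow> real"
  assumes "continuous_on UNIV u" "continuous_on UNIV v" "\<And>x. u x \<le> v x"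
  shows "integral (cbox a b) u \<le> integral (cbox a b) v"
  using assms by (intro integral_le continuous_integrable) auto

lemma divergence_theorem_periodic:
  assumes "Ck 1 u" "periodic_on_box a b u"
    and "\<And>i. i \<in> Basis \<Longrightarrow> Ck 1 (V i)" "\<And>i. i \<in> Basis \<Longrightarrow> periodic_on_box a b (V i)"
  shows "L2_inner a b u (\<lambda>x. \<Sum>i\<in>Basis. partial i (V i) x) = - (\<Sum>i\<in>Basis. L2_inner a b (partial i u) (V i))"
proof -
  have "L2_inner a b u (\<lambda>x. \<Sum>i\<in>Basis. partial i (V i) x) = (\<Sum>i\<in>Basis. L2_inner a b u (partial i (V i)))"
    by (intro L2_inner_sum_right) (blast intro: Ck_continuous Ck_1_partial finite_Basis assms)+
  also have "\<dots> = (\<Sum>i\<in>Basis. - L2_inner a b (partial i u) (V i))"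
    using assms by (intro sum.cong integration_by_parts_periodic) auto
  finally show ?thesis by (simp add: sum_negf)
qed

lemma green_first_identity:
  assumes "Ck 1 u" "periodic_on_box a b u" "Ck 2 v" "periodic_on_box a b v"
  shows "L2_inner a b u (laplacian v) = - (\<Sum>i\<in>Basis. L2_inner a b (partial i u) (partial i v))"
  using divergence_theorem_periodic[of u "\<lambda>i. partial i v"] assms Ck_2_partial periodic_on_box_partial
  unfolding laplacian_def[abs_def] by blast

lemma green_second_identity:
  assumes "Ck 2 u" "periodic_on_box a b u" "Ck 2 v" "periodic_on_box a b v"
  shows "L2_inner a b u (laplacian v) = L2_inner a b v (laplacian u)"
  using green_first_identity[OF Ck_2_imp_1[OF assms(1)] assms(2-4)]
    green_first_identity[OF Ck_2_imp_1[OF assms(3)] assms(4,1,2)]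
  by (simp add: L2_inner_commute)

section \<open>Extrema of periodic functions\<close>

lemma periodic_shift_multiple:
  assumes "periodic_on_box a b u" "i \<in> Basis"
  shows "u (x + (of_int n * ((b - a) \<bullet> i)) *\<^sub>R i) = u x"
proof (induction n rule: int_induct[where k = 0])
  case base
  then show ?case by simp
next
  case (step1 n)
  have "u (x + (of_int (n + 1) * ((b - a) \<bullet> i)) *\<^sub>R i)
      = u (x + (of_int n * ((b - a) \<bullet> i)) *\<^sub>R i + ((b - a) \<bullet> i) *\<^sub>R i)"
    by (simp add: algebra_simps)
  then show ?case
    using assms step1 by (simp add: periodic_on_box_def)
next
  case (step2 n)
  have "u (x + (of_int (n - 1) * ((b - a) \<bullet> i)) *\<^sub>R i)
      = u (x + (of_int (n - 1) * ((b - a) \<bullet> i)) *\<^sub>R i + ((b - a) \<bullet> i) *\<^sub>R i)"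
    using assms by (simp add: periodic_on_box_def)
  also have "\<dots> = u (x + (of_int n * ((b - a) \<bullet> i)) *\<^sub>R i)"
    by (simp add: algebra_simps)
  finally show ?case
    using step2 by simp
qed

text \<open>
Each coordinate is moved into the box by an integer number of periods. Suprema over the box are
therefore suprema over the whole space, where a maximum is never on the boundary.
\<close>

lemma periodic_representative:
  assumes "periodic_on_box a b u"
  obtains y where "y \<in> cbox a b" "u y = u x"
proof -
  define n where "n i = - \<lfloor>(x - a) \<bullet> i / ((b - a) \<bullet> i)\<rfloor>" for i
  define y where "y = x + (\<Sum>i\<in>Basis. (of_int (n i) * ((b - a) \<bullet> i)) *\<^sub>R i)"
  have "u (x + (\<Sum>i\<in>A. (of_int (n i) * ((b - a) \<bullet> i)) *\<^sub>R i)) = u x" if "finite A" "A \<subseteq> Basis" for A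
    using that
  proof (induction A rule: finite_induct)
    case (insert i A)
    then show ?case
      using periodic_shift_multiple[OF assms, of i "x + (\<Sum>i\<in>A. (of_int (n i) * ((b - a) \<bullet> i)) *\<^sub>R i)" "n i"]
      by (simp add: ac_simps)
  qed simp
  then have "u y = u x" by (simp add: y_def)
  moreover have "y \<in> cbox a b"
    unfolding mem_box
  proof
    fix i :: 'a assume i: "i \<in> Basis"
    define L where "L = (b - a) \<bullet> i"
    have L: "0 < L" using box_nondegenerate[OF i] by (simp add: L_def inner_diff_left)
    define q where "q = (x - a) \<bullet> i / L"
    have "x \<bullet> i = a \<bullet> i + q * L" using L by (simp add: q_def inner_diff_left)
    moreover have "y \<bullet> i = x \<bullet> i - of_int \<lfloor>q\<rfloor> * L"
      unfolding y_def inner_add_left inner_sum_left_Basis[OF i] by (simp add: n_def q_def L_def)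
    ultimately have "y \<bullet> i = a \<bullet> i + (q - of_int \<lfloor>q\<rfloor>) * L"
      by (simp add: left_diff_distrib)
    moreover have "0 \<le> (q - of_int \<lfloor>q\<rfloor>) * L"
      using L by simp
    moreover have "(q - of_int \<lfloor>q\<rfloor>) * L \<le> 1 * L"
      using L by (intro mult_right_mono) linarith+
    ultimately show "a \<bullet> i \<le> y \<bullet> i \<and> y \<bullet> i \<le> b \<bullet> i"
      by (simp add: L_def inner_diff_left)
  qed
  ultimately show thesis using that by blast
qed

lemma box_nonempty: "cbox a b \<noteq> {}"
  by (simp add: box_ne_empty(1) box_nondegenerate less_imp_le)

lemma periodic_attains_maximum:
  assumes "continuous_on UNIV u" "periodic_on_box a b u"
  obtains x where "\<And>y. u y \<le> (u x :: real)"
proof -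
  obtain x where x: "x \<in> cbox a b" "\<And>y. y \<in> cbox a b \<Longrightarrow> u y \<le> u x"
    using continuous_attains_sup[OF compact_cbox box_nonempty, of u] assms(1) continuous_on_subset by blast
  have "u y \<le> u x" for y
    using periodic_representative[OF assms(2), of y] x(2) by metis
  then show thesis using that by blast
qed

lemma abs_le_sup_norm:
  assumes "continuous_on UNIV u" "periodic_on_box a b u"
  shows "\<bar>u x\<bar> \<le> sup_norm a b u"
proof -
  obtain y where y: "y \<in> cbox a b" "u y = u x"
    using periodic_representative[OF assms(2)] by blast
  have "compact ((\<lambda>x. \<bar>u x\<bar>) ` cbox a b)"
    using assms(1) by (intro compact_continuous_image continuous_intros) (auto intro: continuous_on_subset)
  then have "bdd_above ((\<lambda>x. \<bar>u x\<bar>) ` cbox a b)"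
    by (intro bounded_imp_bdd_above compact_imp_bounded)
  then have "\<bar>u y\<bar> \<le> sup_norm a b u"
    unfolding sup_norm_def using y(1) by (rule cSUP_upper2) simp_all
  then show ?thesis by (simp add: y(2))
qed

end

section \<open>Dissipation in the schemes\<close>

context periodic_box
begin

lemma kernel_form_L2_nonneg:
  assumes "dissipative_kernel N \<kappa>" "n \<le> N"
    and "\<And>k. k < n \<Longrightarrow> continuous_on UNIV (D k)"
  shows "0 \<le> (\<Sum>k<n. L2_inner a b (D k) (\<lambda>x. \<Sum>j\<le>k. \<kappa> k j * D j x))"
proof -
  have cont: "continuous_on UNIV (\<lambda>x. D k x * (\<Sum>j\<le>k. \<kappa> k j * D j x))" if "k < n" for k
    using that assms(3) by (intro continuous_intros) auto
  have "0 \<le> integral (cbox a b) (\<lambda>x. \<Sum>k<n. D k x * (\<Sum>j\<le>k. \<kappa> k j * D j x))"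
    using dissipative_kernel_form_nonneg[OF assms(1,2)] cont
    by (intro integral_nonneg continuous_integrable continuous_on_sum) auto
  also have "\<dots> = (\<Sum>k<n. L2_inner a b (D k) (\<lambda>x. \<Sum>j\<le>k. \<kappa> k j * D j x))"
    unfolding L2_inner_def using cont by (intro integral_sum continuous_integrable) auto
  finally show ?thesis .
qed

lemma dissipation_L2:
  assumes "dissipative_kernel N \<kappa>" "n \<le> N" "0 < \<gamma>"
    and "\<And>k. k < n \<Longrightarrow> continuous_on UNIV (D k)"
    and scheme: "\<And>k x. k < n \<Longrightarrow> (\<Sum>j\<le>k. \<kappa> k j * D j x) = \<gamma> * - \<mu> k x"
  shows "(\<Sum>k<n. L2_inner a b (\<mu> k) (D k)) \<le> 0"
proof -
  have "L2_inner a b (\<mu> k) (D k) = - L2_inner a b (D k) (\<lambda>x. \<Sum>j\<le>k. \<kappa> k j * D j x) / \<gamma>"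
    if "k < n" for k
    using scheme[OF that] assms(3) by (simp add: L2_inner_def mult_ac)
  then have "(\<Sum>k<n. L2_inner a b (\<mu> k) (D k))
      = - (\<Sum>k<n. L2_inner a b (D k) (\<lambda>x. \<Sum>j\<le>k. \<kappa> k j * D j x)) / \<gamma>"
    by (simp add: sum_negf flip: sum_divide_distrib)
  then show ?thesis
    using kernel_form_L2_nonneg[of N \<kappa> n D] assms(1-4) by simp
qed

text \<open>
Forward substitution in the lower triangular system \<open>\<Sum>\<^sub>j\<^sub>\<le>\<^sub>k \<kappa>\<^sub>k\<^sub>j \<psi>\<^sub>j = \<gamma> \<mu>\<^sub>k\<close>. Taking Laplacians gives the
system solved by the \<open>D\<^sub>k\<close>, and a triangular system has only one solution, so \<open>\<Delta>\<psi>\<^sub>k = D\<^sub>k\<close>.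
\<close>

lemma laplacian_potentials_exist:
  fixes \<kappa> :: "nat \<Rightarrow> nat \<Rightarrow> real"
  assumes "\<And>k. k < n \<Longrightarrow> \<kappa> k k \<noteq> 0"
    and "\<And>k. k < n \<Longrightarrow> Ck 2 (\<mu> k)" "\<And>k. k < n \<Longrightarrow> periodic_on_box a b (\<mu> k)"
    and "\<And>k x. k < n \<Longrightarrow> (\<Sum>j\<le>k. \<kappa> k j * D j x) = \<gamma> * laplacian (\<mu> k) x"
  shows "\<exists>\<psi>. \<forall>k<n. Ck 2 (\<psi> k) \<and> periodic_on_box a b (\<psi> k) \<and> laplacian (\<psi> k) = D k
           \<and> (\<forall>x. (\<Sum>j\<le>k. \<kappa> k j * \<psi> j x) = \<gamma> * \<mu> k x)"
  using assms
proof (induction n)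
  case (Suc n)
  have "\<exists>\<psi>. \<forall>k<n. Ck 2 (\<psi> k) \<and> periodic_on_box a b (\<psi> k) \<and> laplacian (\<psi> k) = D k
      \<and> (\<forall>x. (\<Sum>j\<le>k. \<kappa> k j * \<psi> j x) = \<gamma> * \<mu> k x)"
    by (rule Suc.IH) (use Suc.prems in auto)
  then obtain \<psi> where \<psi>: "\<And>k. k < n \<Longrightarrow> Ck 2 (\<psi> k)" "\<And>k. k < n \<Longrightarrow> periodic_on_box a b (\<psi> k)"
    "\<And>k. k < n \<Longrightarrow> laplacian (\<psi> k) = D k"
    "\<And>k x. k < n \<Longrightarrow> (\<Sum>j\<le>k. \<kappa> k j * \<psi> j x) = \<gamma> * \<mu> k x"
    by blast
  define s where "s x = (\<Sum>j<n. \<kappa> n j * \<psi> j x)" for x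
  define p where "p x = (\<gamma> / \<kappa> n n) * \<mu> n x + (- 1 / \<kappa> n n) * s x" for x
  have diag: "\<kappa> n n \<noteq> 0" using Suc.prems(1) by simp
  have s: "Ck 2 s" unfolding s_def using \<psi> by (intro Ck_sum) auto
  have p: "Ck 2 p"
    unfolding p_def by (rule Ck_linear[OF Suc.prems(2)[OF lessI] s])
  have p_periodic: "periodic_on_box a b p"
    using Suc.prems(3)[of n] \<psi>(2) by (simp add: periodic_on_box_def p_def s_def)
  have "laplacian p x = D n x" for x
  proof -
    have "laplacian s x = (\<Sum>j<n. \<kappa> n j * D j x)"
      unfolding s_def using laplacian_sum[of "{..<n}" \<psi> "\<kappa> n" x] \<psi>(1,3) by simp
    moreover have "(\<Sum>j<n. \<kappa> n j * D j x) + \<kappa> n n * D n x = \<gamma> * laplacian (\<mu> n) x"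
      using Suc.prems(4)[of n x] by (simp add: lessThan_Suc_atMost[symmetric])
    moreover have "laplacian p x = (\<gamma> / \<kappa> n n) * laplacian (\<mu> n) x + (- 1 / \<kappa> n n) * laplacian s x"
      unfolding p_def using s Suc.prems(2) by (intro laplacian_linear) auto
    ultimately have "\<kappa> n n * laplacian p x = \<kappa> n n * D n x"
      using diag by (simp add: right_diff_distrib)
    then show ?thesis using diag by simp
  qed
  then have lap_p: "laplacian p = D n" by blast
  have row: "s x + \<kappa> n n * p x = \<gamma> * \<mu> n x" for x
    using diag by (simp add: p_def right_diff_distrib)
  define \<eta> where "\<eta> = \<psi>(n := p)"
  have \<eta>: "\<eta> n = p" "\<And>k. k < n \<Longrightarrow> \<eta> k = \<psi> k"
    by (auto simp: \<eta>_def)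
  have "(\<Sum>j\<le>k. \<kappa> k j * \<eta> j x) = \<gamma> * \<mu> k x" if "k < Suc n" for k x
  proof (cases "k = n")
    case True
    then show ?thesis
      using row[of x] \<eta> by (simp add: s_def lessThan_Suc_atMost[symmetric])
  next
    case False
    then have "(\<Sum>j\<le>k. \<kappa> k j * \<eta> j x) = (\<Sum>j\<le>k. \<kappa> k j * \<psi> j x)"
      using that \<eta>(2) by (intro sum.cong) auto
    then show ?thesis using \<psi>(4)[of k x] that False by simp
  qed
  moreover have "Ck 2 (\<eta> k) \<and> periodic_on_box a b (\<eta> k) \<and> laplacian (\<eta> k) = D k" if "k < Suc n" for k
    using that \<psi>(1-3) \<eta> p p_periodic lap_p by (cases "k = n") auto
  ultimately show ?case by blast
qed simp

text \<open>
With \<open>D\<^sub>k = \<Delta>\<psi>\<^sub>k\<close> and \<open>\<gamma> \<mu>\<^sub>k = \<Sum>\<^sub>j\<^sub>\<le>\<^sub>k \<kappa>\<^sub>k\<^sub>j \<psi>\<^sub>j\<close>, Green's identity turns \<open>\<gamma> \<Sum>\<^sub>k \<langle>\<mu>\<^sub>k, D\<^sub>k\<rangle>\<close> into minus the sum over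
all directions of the kernel forms of \<open>\<partial>\<^sub>i\<psi>\<close>.
\<close>

lemma dissipation_H_minus_1:
  assumes "dissipative_kernel N \<kappa>" "n \<le> N" "0 < \<gamma>"
    and "\<And>k. k < n \<Longrightarrow> Ck 2 (\<mu> k)" "\<And>k. k < n \<Longrightarrow> periodic_on_box a b (\<mu> k)"
    and "\<And>k x. k < n \<Longrightarrow> (\<Sum>j\<le>k. \<kappa> k j * D j x) = \<gamma> * laplacian (\<mu> k) x"
  shows "(\<Sum>k<n. L2_inner a b (\<mu> k) (D k)) \<le> 0"
proof -
  have "\<kappa> k k \<noteq> 0" if "k < n" for k
    using that assms(1,2) unfolding dissipative_kernel_def by (metis less_irrefl less_le_trans)
  from laplacian_potentials_exist[of n \<kappa> \<mu> D \<gamma>, OF this assms(4-6)]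
  obtain \<psi> where \<psi>: "\<And>k. k < n \<Longrightarrow> Ck 2 (\<psi> k)" "\<And>k. k < n \<Longrightarrow> periodic_on_box a b (\<psi> k)"
    "\<And>k. k < n \<Longrightarrow> laplacian (\<psi> k) = D k"
    "\<And>k x. k < n \<Longrightarrow> (\<Sum>j\<le>k. \<kappa> k j * \<psi> j x) = \<gamma> * \<mu> k x"
    by blast
  have "\<gamma> * L2_inner a b (\<mu> k) (D k)
      = - (\<Sum>i\<in>Basis. L2_inner a b (partial i (\<psi> k)) (\<lambda>x. \<Sum>j\<le>k. \<kappa> k j * partial i (\<psi> j) x))"
    if k: "k < n" for k
  proof -
    define u where "u x = (\<Sum>j\<le>k. \<kappa> k j * \<psi> j x)" for x
    have u: "Ck 1 u"
      unfolding u_def using k by (intro Ck_sum Ck_2_imp_1 \<psi>(1)) auto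
    have u_periodic: "periodic_on_box a b u"
      unfolding periodic_on_box_def u_def
    proof (intro allI ballI sum.cong refl)
      fix x i :: 'a and j assume "i \<in> Basis" "j \<in> {..k}"
      then show "\<kappa> k j * \<psi> j (x + ((b - a) \<bullet> i) *\<^sub>R i) = \<kappa> k j * \<psi> j x"
        using \<psi>(2)[of j] k by (simp add: periodic_on_box_def)
    qed
    have "partial i u x = (\<Sum>j\<le>k. \<kappa> k j * partial i (\<psi> j) x)" for i x
      unfolding u_def using \<psi>(1) k by (intro partial_sum Ck_2_imp_1) auto
    moreover have "L2_inner a b u (laplacian (\<psi> k))
        = - (\<Sum>i\<in>Basis. L2_inner a b (partial i u) (partial i (\<psi> k)))"
      using u u_periodic \<psi> k by (intro green_first_identity) auto
    moreover have "L2_inner a b u (laplacian (\<psi> k)) = \<gamma> * L2_inner a b (\<mu> k) (D k)"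
      using \<psi>(3,4)[OF k] by (simp add: L2_inner_def u_def mult.assoc)
    ultimately show ?thesis
      by (simp add: L2_inner_def mult.commute)
  qed
  then have "\<gamma> * (\<Sum>k<n. L2_inner a b (\<mu> k) (D k))
      = - (\<Sum>k<n. \<Sum>i\<in>Basis. L2_inner a b (partial i (\<psi> k)) (\<lambda>x. \<Sum>j\<le>k. \<kappa> k j * partial i (\<psi> j) x))"
    by (simp add: sum_distrib_left sum_negf)
  also have "\<dots> = - (\<Sum>i\<in>Basis. \<Sum>k<n. L2_inner a b (partial i (\<psi> k)) (\<lambda>x. \<Sum>j\<le>k. \<kappa> k j * partial i (\<psi> j) x))"
    by (subst sum.swap) simp
  also have "\<dots> \<le> 0"
  proof -
    have "0 \<le> (\<Sum>k<n. L2_inner a b (partial i (\<psi> k)) (\<lambda>x. \<Sum>j\<le>k. \<kappa> k j * partial i (\<psi> j) x))"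
      if "i \<in> Basis" for i
      using \<psi>(1) that by (intro kernel_form_L2_nonneg[OF assms(1,2)] Ck_continuous[OF Ck_2_partial])
    then show ?thesis by (simp add: sum_nonneg)
  qed
  finally show ?thesis
    using assms(3) by (simp add: mult_le_0_iff)
qed

lemma scheme_dissipation:
  assumes "dissipative_kernel N \<kappa>" "n \<le> N" "0 < \<gamma>"
    and "\<And>k. k < n \<Longrightarrow> continuous_on UNIV (D k)"
    and "\<And>k. k < n \<Longrightarrow> admissible_potential m (\<mu> k)"
    and "\<And>F k. m = Cahn_Hilliard F \<Longrightarrow> k < n \<Longrightarrow> periodic_on_box a b (\<mu> k)"
    and "\<And>k x. k < n \<Longrightarrow> (\<Sum>j\<le>k. \<kappa> k j * D j x) = \<gamma> * mobility m (\<mu> k) x"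
  shows "(\<Sum>k<n. L2_inner a b (\<mu> k) (D k)) \<le> 0"
proof (cases m)
  case (Cahn_Hilliard F)
  then show ?thesis
    using assms by (intro dissipation_H_minus_1[of N \<kappa> n \<gamma>]) auto
qed (use assms in \<open>auto intro!: dissipation_L2[of N \<kappa> n \<gamma>]\<close>)

text \<open>
Where the mobility is \<open>-1\<close> the scheme itself expresses the potential through the phase fields.
This makes the nonlinear part of the potential integrable without any regularity theory for it.
\<close>

lemma potential_continuous:
  assumes "\<gamma> \<noteq> 0" "admissible_potential m \<mu>" "continuous_on UNIV f"
    and "\<And>x. f x = \<gamma> * mobility m \<mu> x"
  shows "continuous_on UNIV \<mu>"
proof (cases "\<exists>F. m = Cahn_Hilliard F")
  case True
  then show ?thesis using assms(2) Ck_continuous by auto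
next
  case False
  then have "\<mu> = (\<lambda>x. - f x / \<gamma>)"
    using assms(1,4) by (cases m) (auto simp: fun_eq_iff)
  then show ?thesis
    using assms(1,3) by (auto intro!: continuous_intros)
qed

section \<open>Increments of the quadratic energy and of the SAV energy\<close>

lemma phase_field_D:
  assumes "phase_field a b m u"
  shows "periodic_on_box a b u" "Ck 2 u" "is_MBE m \<Longrightarrow> Ck 2 (laplacian u)" "continuous_on UNIV u"
  using assms Ck_continuous by (auto simp: phase_field_def)

lemma phase_field_linear:
  assumes "phase_field a b m u" "phase_field a b m v"
  shows "phase_field a b m (\<lambda>x. c * u x + d * v x)"
proof -
  have "laplacian (\<lambda>x. c * u x + d * v x) = (\<lambda>x. c * laplacian u x + d * laplacian v x)"
    using assms phase_field_D(2) laplacian_linear by blast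
  then show ?thesis
    using assms by (auto simp: phase_field_def periodic_on_box_def intro!: Ck_linear)
qed

lemma linear_part_linear:
  assumes "phase_field a b m u" "phase_field a b m v"
  shows "linear_part \<epsilon> m (\<lambda>x. c * u x + d * v x) = (\<lambda>x. c * linear_part \<epsilon> m u x + d * linear_part \<epsilon> m v x)"
proof -
  have lap: "laplacian (\<lambda>x. c * u x + d * v x) = (\<lambda>x. c * laplacian u x + d * laplacian v x)"
    using assms phase_field_D(2) laplacian_linear by blast
  show ?thesis
    using phase_field_D(3)[OF assms(1)] phase_field_D(3)[OF assms(2)]
    by (cases m) (auto simp: lap laplacian_linear fun_eq_iff algebra_simps)
qed

lemma linear_part_continuous:
  assumes "phase_field a b m u"
  shows "continuous_on UNIV (linear_part \<epsilon> m u)"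
  using phase_field_D[OF assms]
  by (cases m) (auto intro!: continuous_intros Ck_2_laplacian_continuous)

lemma L2_inner_scale: "L2_inner a b (\<lambda>x. c * u x) v = c * L2_inner a b u v"
  by (simp add: L2_inner_def mult.assoc)

lemma linear_part_symmetric:
  assumes "phase_field a b m u" "phase_field a b m v"
  shows "L2_inner a b (linear_part \<epsilon> m u) v = L2_inner a b (linear_part \<epsilon> m v) u"
proof -
  note u = phase_field_D[OF assms(1)] and v = phase_field_D[OF assms(2)]
  have second_order: "L2_inner a b (laplacian u) v = L2_inner a b (laplacian v) u"
    using green_second_identity[of u v] u v by (simp add: L2_inner_commute)
  have fourth_order: "L2_inner a b (laplacian (laplacian u)) v = L2_inner a b (laplacian (laplacian v)) u" if "is_MBE m"
    using green_second_identity[of "laplacian u" v] green_second_identity[of "laplacian v" u] u v that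
    by (simp add: L2_inner_commute periodic_on_box_laplacian)
  show ?thesis
    using second_order fourth_order L2_inner_scale[of "- (\<epsilon>^2)"] L2_inner_scale[of "\<epsilon>^2"]
    by (cases m) simp_all
qed

lemma L2_inner_self_nonneg: "continuous_on UNIV u \<Longrightarrow> 0 \<le> L2_inner a b u u"
  unfolding L2_inner_def by (intro integral_nonneg continuous_integrable continuous_intros) auto

lemma dirichlet_form_nonneg:
  assumes "Ck 2 u" "periodic_on_box a b u"
  shows "L2_inner a b (laplacian u) u \<le> 0"
proof -
  have "0 \<le> (\<Sum>i\<in>Basis. L2_inner a b (partial i u) (partial i u))"
    by (intro sum_nonneg L2_inner_self_nonneg Ck_continuous[OF Ck_2_partial] assms(1))
  then show ?thesis
    using green_first_identity[OF Ck_2_imp_1[OF assms(1)] assms(2,1,2)] L2_inner_commute[of u] by simp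
qed

lemma linear_part_nonneg:
  assumes "phase_field a b m u"
  shows "0 \<le> L2_inner a b (linear_part \<epsilon> m u) u"
proof -
  note u = phase_field_D[OF assms]
  have "L2_inner a b (laplacian u) u \<le> 0"
    using u by (intro dirichlet_form_nonneg)
  moreover have "0 \<le> L2_inner a b (laplacian (laplacian u)) u" if "is_MBE m"
    using green_second_identity[of "laplacian u" u] u that
      L2_inner_self_nonneg[OF Ck_2_laplacian_continuous[OF u(2)]]
    by (simp add: L2_inner_commute periodic_on_box_laplacian)
  ultimately show ?thesis
    using L2_inner_scale[of "- (\<epsilon>^2)"] L2_inner_scale[of "\<epsilon>^2"]
    by (cases m) (simp_all add: mult_nonneg_nonpos)
qed

lemma L2_inner_linear_left:
  assumes "continuous_on UNIV u" "continuous_on UNIV v" "continuous_on UNIV w"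
  shows "L2_inner a b (\<lambda>x. c * v x + d * w x) u = c * L2_inner a b v u + d * L2_inner a b w u"
  using L2_inner_linear_right[OF assms, of c d] by (simp add: L2_inner_commute)

text \<open>
\<open>c = d = 1/2\<close> is the midpoint rule, \<open>c = 1\<close>, \<open>d = 0\<close> the implicit step, and \<open>c = 1\<close>, \<open>d = -1\<close> the energy of
the increment.
\<close>

lemma quadratic_energy_increment:
  assumes "phase_field a b m u" "phase_field a b m v"
  shows "L2_inner a b (linear_part \<epsilon> m (\<lambda>x. c * v x + d * u x)) (\<lambda>x. v x - u x)
       = c * L2_inner a b (linear_part \<epsilon> m v) v - d * L2_inner a b (linear_part \<epsilon> m u) u
         + (d - c) * L2_inner a b (linear_part \<epsilon> m v) u"
proof -
  note cont = phase_field_D(4)[OF assms(1)] phase_field_D(4)[OF assms(2)]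
    linear_part_continuous[OF assms(1), of \<epsilon>] linear_part_continuous[OF assms(2), of \<epsilon>]
  have diff: "L2_inner a b w (\<lambda>x. v x - u x) = L2_inner a b w v - L2_inner a b w u"
    if "continuous_on UNIV w" for w
    using L2_inner_linear_right[OF that cont(2,1), of 1 "-1"] by simp
  have "L2_inner a b (linear_part \<epsilon> m (\<lambda>x. c * v x + d * u x)) (\<lambda>x. v x - u x)
      = c * L2_inner a b (linear_part \<epsilon> m v) (\<lambda>x. v x - u x)
        + d * L2_inner a b (linear_part \<epsilon> m u) (\<lambda>x. v x - u x)"
    unfolding linear_part_linear[OF assms(2,1)]
    using cont by (intro L2_inner_linear_left continuous_intros) auto
  then show ?thesis
    by (simp add: diff cont linear_part_symmetric[OF assms] algebra_simps)
qed

text \<open>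
Additivity for a summand \<open>g\<close> whose continuity is known only through that of the total.
\<close>

lemma L2_inner_split_left:
  assumes "continuous_on UNIV v" "continuous_on UNIV f" "continuous_on UNIV w"
    and "\<And>x. f x = w x + g x"
  shows "L2_inner a b f v = L2_inner a b w v + L2_inner a b g v"
proof -
  have g: "g = (\<lambda>x. f x - w x)" using assms(4) by auto
  have "continuous_on UNIV g" unfolding g using assms by (intro continuous_intros)
  moreover have "f = (\<lambda>x. 1 * w x + 1 * g x)" using assms(4) by auto
  ultimately show ?thesis
    using L2_inner_linear_left[OF assms(1,3), of g 1 1] by simp
qed

text \<open>
Testing with \<open>v - u\<close> gives \<open>(s + r)/(2R) \<langle>g, v - u\<rangle>\<close> for the nonlinear part of the potential; the
equation for the auxiliary variable makes this \<open>(s + r)(s - r)\<close>.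
\<close>

lemma SAV_energy_increment:
  assumes u: "phase_field a b m u" and v: "phase_field a b m v"
    and cont: "continuous_on UNIV \<mu>" and R: "0 < R"
    and potential: "\<And>x. \<mu> x = linear_part \<epsilon> m (\<lambda>y. 1/2 * (v y + u y)) x + (1/2 * (s + r)) / R * g x"
    and aux: "s - r = 1 / (2 * R) * L2_inner a b g (\<lambda>x. v x - u x)"
  shows "SAV_energy \<epsilon> a b m v s - SAV_energy \<epsilon> a b m u r = L2_inner a b \<mu> (\<lambda>x. v x - u x)"
proof -
  let ?d = "\<lambda>x. v x - u x" and ?w = "\<lambda>x. 1/2 * v x + 1/2 * u x"
  have d: "continuous_on UNIV ?d"
    using phase_field_D(4)[OF u] phase_field_D(4)[OF v] by (intro continuous_intros)
  have w: "continuous_on UNIV (linear_part \<epsilon> m ?w)"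
    using phase_field_linear[OF v u] by (rule linear_part_continuous)
  have "L2_inner a b \<mu> ?d = L2_inner a b (linear_part \<epsilon> m ?w) ?d
      + L2_inner a b (\<lambda>x. (1/2 * (s + r)) / R * g x) ?d"
    using d cont w by (rule L2_inner_split_left) (use potential in \<open>simp add: distrib_left\<close>)
  also have "L2_inner a b (\<lambda>x. (1/2 * (s + r)) / R * g x) ?d = (1/2 * (s + r)) / R * (2 * R * (s - r))"
    unfolding L2_inner_scale using R aux by simp
  also have "\<dots> = s^2 - r^2"
    using R by (simp add: power2_eq_square field_simps)
  finally show ?thesis
    unfolding quadratic_energy_increment[OF u v] by (simp add: SAV_energy_def)
qed

end

section \<open>Pointwise bounds for the nonlinear potentials\<close>

text \<open>
The function \<open>M/2 s\<^sup>2 - f s\<close> is convex and so lies above its tangent at \<open>x\<close>.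
\<close>

lemma taylor_upper_bound:
  fixes f f' f'' :: "real \<Rightarrow> real"
  assumes "\<And>s. (f has_real_derivative f' s) (at s)"
    and "\<And>s. (f' has_real_derivative f'' s) (at s)"
    and "\<And>s. f'' s \<le> M"
  shows "f y \<le> f x + f' x * (y - x) + M / 2 * (y - x)\<^sup>2"
proof -
  define h where "h s = M / 2 * s\<^sup>2 - f s" for s
  have h: "(h has_real_derivative M * s - f' s) (at s within S)" for s S
    unfolding h_def using has_field_derivative_at_within[OF assms(1)]
    by (auto intro!: derivative_eq_intros)
  have h': "((\<lambda>s. M * s - f' s) has_real_derivative M - f'' s) (at s)" for s
    using assms(2) by (auto intro!: derivative_eq_intros)
  have "convex_on UNIV h"
    using h h' assms(3) by (intro f''_ge0_imp_convex[where f' = "\<lambda>s. M * s - f' s" and f'' = "\<lambda>s. M - f'' s"]) auto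
  then have "h y - h x \<ge> (M * x - f' x) * (y - x)"
    using h by (intro convex_on_imp_above_tangent[where A = UNIV]) auto
  then show ?thesis
    by (simp add: h_def power2_eq_square field_simps)
qed

text \<open>
The quotient by \<open>(v - u)\<^sup>2\<close> of the exact Taylor remainder is \<open>3/4 u\<^sup>2 + 1/2 u v + 1/4 v\<^sup>2 - 1/2\<close>, which is at most \<open>1\<close>
on the square \<open>[-1, 1]\<^sup>2\<close>.
\<close>

lemma double_well_increment_le:
  fixes u v :: real
  assumes "\<bar>u\<bar> \<le> 1" "\<bar>v\<bar> \<le> 1" "1 \<le> S"
  shows "double_well v - double_well u \<le> (u ^ 3 - u + S * (v - u)) * (v - u)"
proof -
  have "u\<^sup>2 \<le> 1" "v\<^sup>2 \<le> 1"
    using assms by (simp_all add: abs_square_le_1)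
  moreover have "2 * u * v \<le> u\<^sup>2 + v\<^sup>2"
    using sum_squares_bound by blast
  ultimately have "3/4 * u\<^sup>2 + 1/2 * u * v + 1/4 * v\<^sup>2 - 1/2 \<le> S"
    using assms(3) by linarith
  then have "(3/4 * u\<^sup>2 + 1/2 * u * v + 1/4 * v\<^sup>2 - 1/2) * (v - u)\<^sup>2 \<le> S * (v - u)\<^sup>2"
    by (rule mult_right_mono) simp
  moreover have "double_well v - double_well u
      = (u ^ 3 - u) * (v - u) + (3/4 * u\<^sup>2 + 1/2 * u * v + 1/4 * v\<^sup>2 - 1/2) * (v - u)\<^sup>2"
    by (simp add: double_well_def power2_eq_square power3_eq_cube field_simps)
  ultimately show ?thesis
    by (simp add: power2_eq_square algebra_simps)
qed

lemma Ck_2_real_derivatives: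
  fixes F :: "real \<Rightarrow> real"
  assumes "Ck 2 F"
  shows "(F has_real_derivative deriv F s) (at s)"
    and "(deriv F has_real_derivative deriv (deriv F) s) (at s)"
proof -
  have d1: "(F has_real_derivative partial 1 F s) (at s)" for s
    using partial_along_line[of F 0 1 s UNIV] assms by (simp add: numeral_2_eq_2 Ck.simps)
  then have eq1: "deriv F = partial 1 F"
    using DERIV_imp_deriv by blast
  have d2: "(partial 1 F has_real_derivative partial 1 (partial 1 F) s) (at s)" for s
    using partial_along_line[of "partial 1 F" 0 1 s UNIV] assms by (simp add: numeral_2_eq_2 Ck.simps)
  then have "deriv (partial 1 F) = partial 1 (partial 1 F)"
    using DERIV_imp_deriv by blast
  then show "(F has_real_derivative deriv F s) (at s)"
    "(deriv F has_real_derivative deriv (deriv F) s) (at s)"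
    using d1 d2 by (simp_all add: eq1)
qed

lemma Ck_2_real_deriv_continuous:
  fixes F :: "real \<Rightarrow> real"
  assumes "Ck 2 F"
  shows "continuous_on UNIV (deriv F)"
  using Ck_2_real_derivatives(2)[OF assms] by (intro DERIV_continuous_on) auto

lemma truncated_increment_le:
  assumes "truncated_double_well L F" "L / 2 \<le> S"
  shows "F v - F u \<le> (deriv F u + S * (v - u)) * (v - u)"
proof -
  have F: "Ck 2 F" "\<And>s. \<bar>deriv (deriv F) s\<bar> \<le> L"
    using assms(1) by (auto simp: truncated_double_well_def)
  have "F v \<le> F u + deriv F u * (v - u) + L / 2 * (v - u)\<^sup>2"
    using Ck_2_real_derivatives[OF F(1)] F(2) by (intro taylor_upper_bound[where f'' = "deriv (deriv F)"]) (auto intro: order_trans[OF abs_ge_self])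
  moreover have "L / 2 * (v - u)\<^sup>2 \<le> S * (v - u)\<^sup>2"
    using assms(2) by (intro mult_right_mono) auto
  ultimately show ?thesis
    by (simp add: power2_eq_square algebra_simps)
qed

text \<open>
Along a segment with direction \<open>d\<close>, and with \<open>w = 1 + |\<cdot>|\<^sup>2\<close>, the Cauchy--Schwarz inequality bounds the second
derivative of \<open>- 1/2 ln w\<close> by \<open>|d|\<^sup>2 (w - 2) / w\<^sup>2\<close>. Since \<open>(w - 4)\<^sup>2 \<ge> 0\<close>, this is at most \<open>|d|\<^sup>2 / 8\<close>, and half of it
is the constant \<open>1/16\<close>.
\<close>

lemma log_potential_increment_le:
  fixes p q :: "'a::euclidean_space"
  assumes "1/16 \<le> S"
  shows "- (1/2) * ln (1 + (norm q)\<^sup>2) + 1/2 * ln (1 + (norm p)\<^sup>2)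
         \<le> - ((q - p) \<bullet> p) / (1 + (norm p)\<^sup>2) + S * (norm (q - p))\<^sup>2"
proof -
  define d where "d = q - p"
  define A where "A = d \<bullet> d"
  define B where "B = p \<bullet> d"
  define w where "w s = (1 + p \<bullet> p) + 2 * s * B + s\<^sup>2 * A" for s
  have w_eq: "w s = 1 + (p + s *\<^sub>R d) \<bullet> (p + s *\<^sub>R d)" for s
    by (simp add: w_def A_def B_def inner_add_left inner_add_right inner_commute power2_eq_square algebra_simps)
  have w_pos: "1 \<le> w s" for s
    by (simp add: w_eq)
  define g where "g s = - (1/2) * ln (w s)" for s
  define g' where "g' s = - (B + s * A) / w s" for s
  define g'' where "g'' s = - A / w s + 2 * (B + s * A)\<^sup>2 / (w s)\<^sup>2" for s
  have dw: "(w has_real_derivative 2 * (B + s * A)) (at s)" for s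
    unfolding w_def by (auto intro!: derivative_eq_intros)
  have dg: "(g has_real_derivative g' s) (at s)" for s
  proof -
    have "0 < w s" using w_pos[of s] by linarith
    then show ?thesis
      unfolding g_def g'_def by (auto intro!: derivative_eq_intros dw simp: field_simps)
  qed
  have dg': "(g' has_real_derivative g'' s) (at s)" for s
  proof -
    have "0 < w s" using w_pos[of s] by linarith
    then show ?thesis
      unfolding g'_def g''_def by (auto intro!: derivative_eq_intros dw simp: field_simps power2_eq_square)
  qed
  have "g'' s \<le> A / 8" for s
  proof -
    have pos: "0 < w s" using w_pos[of s] by linarith
    have "B + s * A = (p + s *\<^sub>R d) \<bullet> d"
      by (simp add: A_def B_def inner_add_left)
    then have "(B + s * A)\<^sup>2 \<le> (w s - 1) * A"
      using Cauchy_Schwarz_ineq[of "p + s *\<^sub>R d" d] by (simp add: w_eq A_def)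
    then have "g'' s \<le> - A / w s + 2 * ((w s - 1) * A) / (w s)\<^sup>2"
      unfolding g''_def by (intro add_left_mono divide_right_mono mult_left_mono) auto
    also have "\<dots> = A * ((w s - 2) / (w s)\<^sup>2)"
      using pos by (simp add: field_simps power2_eq_square)
    also have "\<dots> \<le> A * (1 / 8)"
    proof (rule mult_left_mono)
      have "0 \<le> (w s - 4)\<^sup>2" by simp
      then show "(w s - 2) / (w s)\<^sup>2 \<le> 1 / 8"
        using pos by (simp add: field_simps power2_eq_square)
    qed (simp add: A_def)
    finally show ?thesis by simp
  qed
  from taylor_upper_bound[OF dg dg' this, of 1 0]
  have "g 1 \<le> g 0 + g' 0 + A / 16" by simp
  moreover have "w 1 = 1 + (norm q)\<^sup>2" "w 0 = 1 + (norm p)\<^sup>2"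
    by (simp_all add: w_eq d_def power2_norm_eq_inner)
  moreover have "A / 16 \<le> S * A"
    using mult_right_mono[OF assms, of A] by (simp add: A_def)
  ultimately show ?thesis
    by (simp add: g_def g'_def A_def B_def d_def power2_norm_eq_inner inner_commute)
qed

section \<open>Increments of the classical energy\<close>

context periodic_box
begin

lemma well_energy_increment_le:
  assumes "continuous_on UNIV u" "continuous_on UNIV v" "continuous_on UNIV F" "continuous_on UNIV g"
    and "\<And>x. F (v x) - F (u x) \<le> (g x + S * (v x - u x)) * (v x - u x)"
  shows "integral (cbox a b) (\<lambda>x. F (v x)) - integral (cbox a b) (\<lambda>x. F (u x))
       \<le> L2_inner a b (\<lambda>x. g x + S * (v x - u x)) (\<lambda>x. v x - u x)"
proof -
  have cont: "continuous_on UNIV (\<lambda>x. F (v x))" "continuous_on UNIV (\<lambda>x. F (u x))"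
    using assms(1-3) continuous_on_compose2 by blast+
  have "integral (cbox a b) (\<lambda>x. F (v x)) - integral (cbox a b) (\<lambda>x. F (u x))
      = integral (cbox a b) (\<lambda>x. F (v x) - F (u x))"
    using cont by (intro integral_diff[symmetric] continuous_integrable)
  also have "\<dots> \<le> L2_inner a b (\<lambda>x. g x + S * (v x - u x)) (\<lambda>x. v x - u x)"
    unfolding L2_inner_def using assms(1-2,4,5) cont
    by (intro integral_mono_continuous continuous_intros) auto
  finally show ?thesis .
qed

text \<open>
The variational derivative and the stabilization together are the divergence of the field
\<open>X = \<nabla>u / (1 + |\<nabla>u|\<^sup>2) - S \<nabla>d\<close> with \<open>d = v - u\<close>, so their inner product with \<open>d\<close> is the integral of
\<open>- \<nabla>d \<bullet> X\<close>, which bounds the increment of the potential pointwise.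
\<close>

lemma log_energy_increment_le:
  assumes u: "Ck 2 u" "periodic_on_box a b u" and v: "Ck 2 v" "periodic_on_box a b v" and S: "1/16 \<le> S"
  shows "E1 a b MBE_no_slope v - E1 a b MBE_no_slope u
       \<le> L2_inner a b (\<lambda>x. dE1 MBE_no_slope u x + stabilization MBE_no_slope S (\<lambda>y. v y - u y) x)
           (\<lambda>x. v x - u x)"
proof -
  define d where "d x = v x - u x" for x
  define V where "V i x = (grad u x /\<^sub>R (1 + (norm (grad u x))\<^sup>2)) \<bullet> i" for i x
  define X where "X i x = 1 * V i x + (- S) * partial i d x" for i x
  have d: "Ck 2 d" "periodic_on_box a b d"
    using Ck_linear[OF v(1) u(1), of 1 "-1"] u(2) v(2) by (simp_all add: d_def[abs_def] periodic_on_box_def)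
  have grad_d: "grad d x = grad v x - grad u x" for x
  proof -
    have "partial i d x = partial i v x - partial i u x" for i
      using partial_linear[of v x u i 1 "-1"] u(1) v(1) by (simp add: d_def[abs_def] numeral_2_eq_2 Ck.simps)
    then show ?thesis
      by (simp add: grad_def scaleR_left_diff_distrib sum_subtractf)
  qed
  have V: "Ck 1 (V i)" "periodic_on_box a b (V i)" if "i \<in> Basis" for i
  proof -
    show "Ck 1 (V i)"
      unfolding V_def using u(1) that by (rule Ck_1_normalized_gradient)
    have "\<And>j. periodic_on_box a b (partial j u)"
      using u(2) by (rule periodic_on_box_partial)
    then show "periodic_on_box a b (V i)"
      by (simp add: periodic_on_box_def V_def grad_def)
  qed
  have X: "Ck 1 (X i)" "periodic_on_box a b (X i)" if "i \<in> Basis" for i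
  proof -
    show "Ck 1 (X i)"
      unfolding X_def using that d V by (intro Ck_linear Ck_2_partial)
    show "periodic_on_box a b (X i)"
      using V(2)[OF that] periodic_on_box_partial[OF d(2), of i] by (simp add: X_def periodic_on_box_def)
  qed
  have cont_d: "continuous_on UNIV (partial i d)" if "i \<in> Basis" for i
    using d(1) that by (intro Ck_continuous[OF Ck_2_partial])
  have integrand: "(\<Sum>i\<in>Basis. - (partial i d x * X i x))
      = - ((grad v x - grad u x) \<bullet> grad u x) / (1 + (norm (grad u x))\<^sup>2) + S * (norm (grad v x - grad u x))\<^sup>2" for x
  proof -
    have "(\<Sum>i\<in>Basis. - (partial i d x * X i x))
        = - (\<Sum>i\<in>Basis. (grad d x \<bullet> i) * ((grad u x /\<^sub>R (1 + (norm (grad u x))\<^sup>2)) \<bullet> i))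
          + S * (\<Sum>i\<in>Basis. (grad d x \<bullet> i) * (grad d x \<bullet> i))"
      unfolding sum_negf[symmetric] sum_distrib_left sum.distrib[symmetric]
      by (intro sum.cong) (auto simp: X_def V_def grad_inner algebra_simps)
    also have "\<dots> = - (grad d x \<bullet> (grad u x /\<^sub>R (1 + (norm (grad u x))\<^sup>2))) + S * (grad d x \<bullet> grad d x)"
      by (simp only: euclidean_inner[symmetric])
    finally show ?thesis
      by (simp add: grad_d power2_norm_eq_inner divide_inverse mult.commute)
  qed
  have cont_log: "continuous_on UNIV (\<lambda>x. - (1/2) * ln (1 + (norm (grad w x))\<^sup>2))" if "Ck 2 w" for w :: "'a \<Rightarrow> real"
    using grad_continuous[OF Ck_2_imp_1[OF that]]
    by (intro continuous_intros) (auto simp: add_pos_nonneg less_imp_neq[symmetric] intro!: add_pos_nonneg less_imp_neq[symmetric])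
  have "E1 a b MBE_no_slope v - E1 a b MBE_no_slope u
      = integral (cbox a b) (\<lambda>x. - (1/2) * ln (1 + (norm (grad v x))\<^sup>2) - - (1/2) * ln (1 + (norm (grad u x))\<^sup>2))"
    unfolding E1.simps using cont_log u v by (intro integral_diff[symmetric] continuous_integrable) auto
  also have "\<dots> \<le> integral (cbox a b) (\<lambda>x. \<Sum>i\<in>Basis. - (partial i d x * X i x))"
  proof (rule integral_mono_continuous)
    show "continuous_on UNIV (\<lambda>x. - (1/2) * ln (1 + (norm (grad v x))\<^sup>2) - - (1/2) * ln (1 + (norm (grad u x))\<^sup>2))"
      by (intro continuous_on_diff cont_log u v)
    show "continuous_on UNIV (\<lambda>x. \<Sum>i\<in>Basis. - (partial i d x * X i x))"
      using cont_d Ck_continuous[OF X(1)] by (intro continuous_intros) auto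
    show "- (1/2) * ln (1 + (norm (grad v x))\<^sup>2) - - (1/2) * ln (1 + (norm (grad u x))\<^sup>2)
        \<le> (\<Sum>i\<in>Basis. - (partial i d x * X i x))" for x
      using log_potential_increment_le[OF S, of "grad v x" "grad u x"] by (simp add: integrand)
  qed
  also have "\<dots> = - (\<Sum>i\<in>Basis. L2_inner a b (partial i d) (X i))"
    unfolding L2_inner_def sum_negf[symmetric] integral_neg[symmetric]
    using cont_d Ck_continuous[OF X(1)]
    by (subst integral_sum) (auto intro!: continuous_integrable continuous_intros)
  also have "\<dots> = L2_inner a b d (\<lambda>x. \<Sum>i\<in>Basis. partial i (X i) x)"
    using d X Ck_2_imp_1 by (intro divergence_theorem_periodic[symmetric]) auto
  also have "(\<lambda>x. \<Sum>i\<in>Basis. partial i (X i) x)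
      = (\<lambda>x. dE1 MBE_no_slope u x + stabilization MBE_no_slope S (\<lambda>y. v y - u y) x)"
  proof
    fix x
    have "partial i (X i) x = 1 * partial i (V i) x + (- S) * partial i (partial i d) x" if "i \<in> Basis" for i
      unfolding X_def using V(1)[OF that] Ck_2_partial[OF d(1) that]
      by (intro partial_linear) (auto simp: Ck.simps)
    then show "(\<Sum>i\<in>Basis. partial i (X i) x)
        = dE1 MBE_no_slope u x + stabilization MBE_no_slope S (\<lambda>y. v y - u y) x"
      by (simp add: divergence_def laplacian_def V_def[abs_def] d_def[abs_def] sum_subtractf sum_distrib_left sum_negf)
  qed
  finally show ?thesis
    by (simp only: d_def[abs_def] L2_inner_commute)
qed

lemma explicit_energy_increment_le:
  assumes "stabilized_model m S" "phase_field a b m u" "phase_field a b m v"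
    and "m = Allen_Cahn \<Longrightarrow> \<forall>x. \<bar>u x\<bar> \<le> 1 \<and> \<bar>v x\<bar> \<le> 1"
  shows "E1 a b m v - E1 a b m u
       \<le> L2_inner a b (\<lambda>x. dE1 m u x + stabilization m S (\<lambda>y. v y - u y) x) (\<lambda>x. v x - u x)"
proof (cases m)
  case Allen_Cahn
  have "continuous_on UNIV double_well"
    unfolding double_well_def[abs_def] by (intro continuous_intros)
  moreover have "continuous_on UNIV (\<lambda>x. (u x) ^ 3 - u x)"
    using phase_field_D(4)[OF assms(2)] by (intro continuous_intros)
  ultimately show ?thesis
    using assms Allen_Cahn phase_field_D(4)
    by (auto intro!: well_energy_increment_le double_well_increment_le)
next
  case (Cahn_Hilliard F)
  then obtain L where L: "truncated_double_well L F" "L / 2 \<le> S"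
    using assms(1) by auto
  then have F: "Ck 2 F" by (simp add: truncated_double_well_def)
  have "continuous_on UNIV (\<lambda>x. deriv F (u x))"
    using phase_field_D(4)[OF assms(2)] Ck_2_real_deriv_continuous[OF F] continuous_on_compose2 by blast
  then show ?thesis
    using assms(2,3) Cahn_Hilliard phase_field_D(4) Ck_continuous[OF F] truncated_increment_le[OF L]
    by (auto intro!: well_energy_increment_le)
next
  case MBE_no_slope
  have "1/16 \<le> S" using assms(1) MBE_no_slope by simp
  then show ?thesis
    unfolding MBE_no_slope using phase_field_D(1,2)[OF assms(2)] phase_field_D(1,2)[OF assms(3)]
    by (intro log_energy_increment_le)
qed (use assms(1) in simp)

text \<open>
The implicit treatment of the quadratic part loses half the energy of the increment, which has
the right sign.
\<close>

lemma classical_energy_increment_le: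
  assumes "stabilized_model m S" and u: "phase_field a b m u" and v: "phase_field a b m v"
    and "m = Allen_Cahn \<Longrightarrow> \<forall>x. \<bar>u x\<bar> \<le> 1 \<and> \<bar>v x\<bar> \<le> 1"
    and cont: "continuous_on UNIV \<mu>"
    and potential: "\<And>x. \<mu> x = linear_part \<epsilon> m v x + dE1 m u x + stabilization m S (\<lambda>y. v y - u y) x"
  shows "classical_energy \<epsilon> a b m v - classical_energy \<epsilon> a b m u \<le> L2_inner a b \<mu> (\<lambda>x. v x - u x)"
proof -
  let ?d = "\<lambda>x. v x - u x" and ?L = "\<lambda>f g. L2_inner a b (linear_part \<epsilon> m f) g"
  have d: "continuous_on UNIV ?d"
    using phase_field_D(4)[OF u] phase_field_D(4)[OF v] by (intro continuous_intros)
  have "L2_inner a b \<mu> ?d = ?L v ?d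
      + L2_inner a b (\<lambda>x. dE1 m u x + stabilization m S ?d x) ?d"
    using d cont linear_part_continuous[OF v]
    by (rule L2_inner_split_left) (simp add: potential)
  moreover have "?L v ?d = ?L v v - ?L v u"
    using quadratic_energy_increment[OF u v, of \<epsilon> 1 0] by simp
  moreover have "0 \<le> ?L v v + ?L u u - 2 * ?L v u"
    using quadratic_energy_increment[OF u v, of \<epsilon> 1 "-1"] linear_part_nonneg[OF phase_field_linear[OF v u, of 1 "-1"], of \<epsilon>]
    by simp
  moreover have "E1 a b m v - E1 a b m u \<le> L2_inner a b (\<lambda>x. dE1 m u x + stabilization m S ?d x) ?d"
    using assms(1-4) by (rule explicit_energy_increment_le)
  ultimately show ?thesis
    unfolding classical_energy_def
    using L2_inner_commute[of v "linear_part \<epsilon> m v"] L2_inner_commute[of u "linear_part \<epsilon> m u"] by linarith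
qed

section \<open>The discrete maximum principle for Allen--Cahn\<close>

text \<open>
Look at a maximum point \<open>y\<close> of the new phase field, where its Laplacian is nonpositive. The history
term is a combination of old values, with nonnegative weights of total \<open>c k\<close>, hence at most \<open>c k\<close>; and
\<open>s - s\<^sup>3 + S s \<le> S\<close> for \<open>|s| \<le> 1\<close>, since the difference factors as \<open>(1 - s) (S - s (1 + s))\<close>. This is where
\<open>S \<ge> 2\<close> enters.
\<close>

lemma Allen_Cahn_step_le_1:
  assumes c: "\<And>j. j \<le> k \<Longrightarrow> 0 \<le> backward_diff c j" "0 < c k"
    and "0 < \<gamma>" "2 \<le> S" "Ck 2 (\<phi> (Suc k))" "periodic_on_box a b (\<phi> (Suc k))"
    and previous: "\<And>j x. j \<le> k \<Longrightarrow> \<bar>\<phi> j x\<bar> \<le> 1"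
    and scheme: "\<And>x. (\<Sum>j\<le>k. c j * (\<phi> (Suc j) x - \<phi> j x))
      = \<gamma> * (\<epsilon>\<^sup>2 * laplacian (\<phi> (Suc k)) x - ((\<phi> k x) ^ 3 - \<phi> k x) - S * (\<phi> (Suc k) x - \<phi> k x))"
  shows "\<phi> (Suc k) x \<le> 1"
proof -
  obtain y where y: "\<And>x. \<phi> (Suc k) x \<le> \<phi> (Suc k) y"
    using periodic_attains_maximum[OF Ck_continuous] assms(5,6) by blast
  define s where "s = \<phi> k y"
  have s: "s \<le> 1" "-1 \<le> s" using previous[of k y] by (auto simp: s_def)
  have "0 \<le> (1 - s) * (S - s * (1 + s))"
  proof (rule mult_nonneg_nonneg)
    have "s * (1 + s) \<le> 1 + s" using mult_right_mono[of s 1 "1 + s"] s by simp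
    then show "0 \<le> S - s * (1 + s)" using s assms(4) by linarith
  qed (use s in simp)
  then have reaction: "s - s ^ 3 + S * s \<le> S"
    by (simp add: power3_eq_cube algebra_simps)
  have "laplacian (\<phi> (Suc k)) y \<le> 0"
    using assms(5) y by (rule laplacian_nonpos_at_maximum)
  then have lap: "\<epsilon>\<^sup>2 * laplacian (\<phi> (Suc k)) y \<le> 0"
    by (simp add: mult_nonneg_nonpos)
  have "(\<Sum>j\<le>k. backward_diff c j * \<phi> j y) \<le> (\<Sum>j\<le>k. backward_diff c j * 1)"
    using c(1) previous by (intro sum_mono mult_left_mono) (auto simp: abs_le_iff)
  then have history: "(\<Sum>j\<le>k. backward_diff c j * \<phi> j y) \<le> c k"
    by (simp add: sum_backward_diff)
  have "c k * \<phi> (Suc k) y - (\<Sum>j\<le>k. backward_diff c j * \<phi> j y)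
      = \<gamma> * (\<epsilon>\<^sup>2 * laplacian (\<phi> (Suc k)) y - (s ^ 3 - s) - S * (\<phi> (Suc k) y - s))"
    using scheme[of y] sum_increment_by_parts[of c "\<lambda>j. \<phi> j y" k] by (simp add: s_def)
  also have "\<dots> \<le> \<gamma> * (S - S * \<phi> (Suc k) y)"
    using lap reaction assms(3) by (intro mult_left_mono) (simp_all add: algebra_simps)
  finally have "(c k + \<gamma> * S) * \<phi> (Suc k) y \<le> (c k + \<gamma> * S) * 1"
    using history by (simp add: algebra_simps)
  moreover have "0 < c k + \<gamma> * S"
    using c(2) assms(3,4) by (intro add_pos_nonneg) auto
  ultimately have "\<phi> (Suc k) y \<le> 1"
    by (simp only: mult_le_cancel_left_pos)
  then show ?thesis using y[of x] by linarith
qed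

text \<open>
The lower bound is the upper bound for \<open>- \<phi>\<close>, which solves the same equation because the reaction term is odd.
\<close>

lemma Allen_Cahn_maximum_principle:
  assumes c: "\<And>k j. k < N \<Longrightarrow> j \<le> k \<Longrightarrow> 0 \<le> backward_diff (c k) j" "\<And>k. k < N \<Longrightarrow> 0 < c k k"
    and "0 < \<gamma>" "2 \<le> S"
    and \<phi>: "\<And>n. n \<le> N \<Longrightarrow> Ck 2 (\<phi> n)" "\<And>n. n \<le> N \<Longrightarrow> periodic_on_box a b (\<phi> n)"
    and initial: "\<And>x. \<bar>\<phi> 0 x\<bar> \<le> 1"
    and scheme: "\<And>k x. k < N \<Longrightarrow> (\<Sum>j\<le>k. c k j * (\<phi> (Suc j) x - \<phi> j x))
      = \<gamma> * (\<epsilon>\<^sup>2 * laplacian (\<phi> (Suc k)) x - ((\<phi> k x) ^ 3 - \<phi> k x) - S * (\<phi> (Suc k) x - \<phi> k x))"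
    and "n \<le> N"
  shows "\<bar>\<phi> n x\<bar> \<le> 1"
  using \<open>n \<le> N\<close>
proof (induction n arbitrary: x rule: less_induct)
  case (less n)
  show ?case
  proof (cases n)
    case (Suc k)
    have k: "k < N" using less.prems Suc by simp
    have previous: "\<bar>\<phi> j x\<bar> \<le> 1" if "j \<le> k" for j x
      using less.IH[of j x] less.prems that Suc by simp
    have upper: "\<phi> (Suc k) x \<le> 1"
      using c k assms(3,4) \<phi> previous scheme by (intro Allen_Cahn_step_le_1[where c = "c k" and \<phi> = \<phi>]) auto
    \<comment> \<open>\<open>- \<phi>\<close>, written as a linear combination to fit the linearity lemmas\<close>
    define \<omega> where "\<omega> j x = (-1) * \<phi> j x + 0 * \<phi> j x" for j x
    have lap: "laplacian (\<omega> (Suc k)) x = - laplacian (\<phi> (Suc k)) x" for x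
      unfolding \<omega>_def using laplacian_linear[of "\<phi> (Suc k)" "\<phi> (Suc k)" "-1" 0 x] \<phi>(1)[of "Suc k"] k by simp
    have "\<omega> (Suc k) x \<le> 1"
    proof (rule Allen_Cahn_step_le_1[where c = "c k" and \<phi> = \<omega> and \<epsilon> = \<epsilon> and \<gamma> = \<gamma> and S = S])
      show "Ck 2 (\<omega> (Suc k))"
        unfolding \<omega>_def using \<phi>(1)[of "Suc k"] k by (intro Ck_linear) auto
      show "periodic_on_box a b (\<omega> (Suc k))"
        using \<phi>(2)[of "Suc k"] k by (simp add: periodic_on_box_def \<omega>_def)
      show "(\<Sum>j\<le>k. c k j * (\<omega> (Suc j) x - \<omega> j x))
          = \<gamma> * (\<epsilon>\<^sup>2 * laplacian (\<omega> (Suc k)) x - ((\<omega> k x) ^ 3 - \<omega> k x) - S * (\<omega> (Suc k) x - \<omega> k x))" for x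
      proof -
        have "(\<Sum>j\<le>k. c k j * (\<omega> (Suc j) x - \<omega> j x)) = - (\<Sum>j\<le>k. c k j * (\<phi> (Suc j) x - \<phi> j x))"
          unfolding sum_negf[symmetric] by (intro sum.cong) (auto simp: \<omega>_def algebra_simps)
        then show ?thesis
          unfolding scheme[OF k] lap by (simp add: \<omega>_def power3_eq_cube algebra_simps)
      qed
    qed (use c k assms(3,4) previous in \<open>auto simp: \<omega>_def\<close>)
    then show ?thesis
      using upper Suc by (simp add: \<omega>_def abs_le_iff)
  qed (use initial in simp)
qed

end

section \<open>Decay of both energies\<close>

lemma energy_le_initial:
  fixes E :: "nat \<Rightarrow> real"
  assumes "\<And>k. k < n \<Longrightarrow> E (Suc k) - E k \<le> w k" "(\<Sum>k<n. w k) \<le> 0"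
  shows "E n \<le> E 0"
proof -
  have "E n - E 0 = (\<Sum>k<n. E (Suc k) - E k)"
    by (simp add: sum_lessThan_telescope)
  also have "\<dots> \<le> (\<Sum>k<n. w k)"
    using assms(1) by (intro sum_mono) auto
  finally show ?thesis using assms(2) by simp
qed

context periodic_box
begin

lemma stabilized_L1_energy_le:
  assumes "0 < \<alpha>" "\<alpha> < 1" "0 < \<gamma>" "time_mesh T N t"
    and stable: "stabilized_model m S"
    and sol: "stabilized_L1_solution \<alpha> \<gamma> \<epsilon> a b N t m S \<phi>"
    and initial: "m = Allen_Cahn \<Longrightarrow> sup_norm a b (\<phi> 0) \<le> 1"
    and n: "n \<le> N"
  shows "classical_energy \<epsilon> a b m (\<phi> n) \<le> classical_energy \<epsilon> a b m (\<phi> 0)"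
proof -
  define c where "c k j = 1 / Gamma (2 - \<alpha>) * power_kernel (1 - \<alpha>) t (\<lambda>k. t (Suc k)) k j" for k j
  define D where "D k x = \<phi> (Suc k) x - \<phi> k x" for k x
  define \<mu> where "\<mu> = stabilized_potential \<epsilon> m S \<phi>"
  have Gamma_pos: "0 < 1 / Gamma (2 - \<alpha>)"
    using assms(2) by (simp add: Gamma_real_pos)
  have mesh: "collocated_mesh (1 - \<alpha>) N t (\<lambda>k. t (Suc k))"
    using assms(1,2,4) by (rule collocated_mesh_right)
  have kernel: "dissipative_kernel N c"
    unfolding c_def using collocated_mesh.dissipative_power_kernel[OF mesh] Gamma_pos
    by (rule dissipative_kernel_scale)
  have field: "phase_field a b m (\<phi> k)" if "k \<le> N" for k
    using sol that by (simp add: stabilized_L1_solution_def)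
  have admissible: "admissible_potential m (\<mu> k)" if "k < N" for k
    using sol that by (simp add: stabilized_L1_solution_def \<mu>_def)
  have scheme: "(\<Sum>j\<le>k. c k j * D j x) = \<gamma> * mobility m (\<mu> k) x" if "k < N" for k x
    using sol that L1_deriv_eq_power_kernel[of \<alpha> t \<phi> k x]
    by (simp add: stabilized_L1_solution_def \<mu>_def D_def c_def)
  have D_cont: "continuous_on UNIV (D k)" if "k < N" for k
    unfolding D_def using that by (intro continuous_on_diff phase_field_D(4)[OF field]) auto
  have \<mu>_cont: "continuous_on UNIV (\<mu> k)" if "k < N" for k
  proof (rule potential_continuous[OF _ admissible[OF that] _ scheme[OF that]])
    show "continuous_on UNIV (\<lambda>x. \<Sum>j\<le>k. c k j * D j x)"
      using D_cont that by (intro continuous_intros) auto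
  qed (use assms(3) in simp)
  have bound: "\<bar>\<phi> k x\<bar> \<le> 1" if AC: "m = Allen_Cahn" and "k \<le> N" for k x
  proof (rule Allen_Cahn_maximum_principle[where c = c and \<gamma> = \<gamma> and S = S and \<epsilon> = \<epsilon>])
    show "0 \<le> backward_diff (c k) j" if "k < N" "j \<le> k" for k j
      unfolding c_def[abs_def] backward_diff_scale
      using backward_diff_kernel_right_nonneg[OF mesh that] Gamma_pos by (intro mult_nonneg_nonneg) auto
    show "0 < c k k" if "k < N" for k
      using kernel that by (simp add: dissipative_kernel_def)
    show "\<bar>\<phi> 0 x\<bar> \<le> 1" for x
      using abs_le_sup_norm[of "\<phi> 0" x] phase_field_D(1,4)[OF field[of 0]] initial[OF AC] by simp
    show "(\<Sum>j\<le>k. c k j * (\<phi> (Suc j) x - \<phi> j x))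
        = \<gamma> * (\<epsilon>\<^sup>2 * laplacian (\<phi> (Suc k)) x - ((\<phi> k x) ^ 3 - \<phi> k x) - S * (\<phi> (Suc k) x - \<phi> k x))"
      if "k < N" for k x
      using scheme[OF that, of x] AC by (simp add: D_def \<mu>_def stabilized_potential_def)
  qed (use assms(3) stable AC \<open>k \<le> N\<close> phase_field_D(1,2)[OF field] in auto)
  have "classical_energy \<epsilon> a b m (\<phi> (Suc k)) - classical_energy \<epsilon> a b m (\<phi> k) \<le> L2_inner a b (\<mu> k) (D k)"
    if "k < n" for k
    unfolding D_def
    by (rule classical_energy_increment_le[OF stable])
      (use that n field bound \<mu>_cont in \<open>auto simp: \<mu>_def stabilized_potential_def\<close>)
  moreover have "(\<Sum>k<n. L2_inner a b (\<mu> k) (D k)) \<le> 0"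
  proof (rule scheme_dissipation[OF kernel n assms(3)])
    fix F k assume CH: "m = Cahn_Hilliard F" and "k < n"
    then have "periodic_on_box a b (\<phi> k)" "periodic_on_box a b (\<phi> (Suc k))"
      using n phase_field_D(1)[OF field] by simp_all
    then show "periodic_on_box a b (\<mu> k)"
      using periodic_on_box_laplacian[of a b "\<phi> (Suc k)"] CH
      by (simp add: periodic_on_box_def \<mu>_def stabilized_potential_def)
  qed (use n D_cont admissible scheme in auto)
  ultimately show ?thesis
    by (rule energy_le_initial[where E = "\<lambda>k. classical_energy \<epsilon> a b m (\<phi> k)"])
qed

lemma L1_SAV_energy_le:
  assumes "0 < \<alpha>" "\<alpha> < 1" "0 < \<gamma>" "time_mesh T N t"
    and sol: "L1_SAV_solution \<alpha> \<gamma> \<epsilon> a b N t m C0 \<phi>m \<phi> r"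
    and n: "n \<le> N"
  shows "SAV_energy \<epsilon> a b m (\<phi> n) (r n) \<le> SAV_energy \<epsilon> a b m (\<phi> 0) (r 0)"
proof -
  define c where "c k j = 1 / Gamma (2 - \<alpha>) * power_kernel (1 - \<alpha>) t (\<lambda>k. (t k + t (Suc k)) / 2) k j" for k j
  define D where "D k x = \<phi> (Suc k) x - \<phi> k x" for k x
  define \<mu> where "\<mu> = SAV_potential \<epsilon> a b m C0 \<phi>m \<phi> r"
  have kernel: "dissipative_kernel N c"
    unfolding c_def
    using collocated_mesh.dissipative_power_kernel[OF collocated_mesh_midpoint[OF assms(1,2,4)]]
    by (rule dissipative_kernel_scale) (use assms(2) in \<open>simp add: Gamma_real_pos\<close>)
  have field: "phase_field a b m (\<phi> k)" if "k \<le> N" for k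
    using sol that by (simp add: L1_SAV_solution_def)
  have admissible: "admissible_potential m (\<mu> k)" if "k < N" for k
    using sol that by (simp add: L1_SAV_solution_def \<mu>_def)
  have scheme: "(\<Sum>j\<le>k. c k j * D j x) = \<gamma> * mobility m (\<mu> k) x" if "k < N" for k x
    using sol that L1_half_deriv_eq_power_kernel[OF assms(1,2,4) that, of \<phi> x]
    by (simp add: L1_SAV_solution_def \<mu>_def D_def c_def)
  have D_cont: "continuous_on UNIV (D k)" if "k < N" for k
    unfolding D_def using that by (intro continuous_on_diff phase_field_D(4)[OF field]) auto
  have \<mu>_cont: "continuous_on UNIV (\<mu> k)" if "k < N" for k
  proof (rule potential_continuous[OF _ admissible[OF that] _ scheme[OF that]])
    show "continuous_on UNIV (\<lambda>x. \<Sum>j\<le>k. c k j * D j x)"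
      using D_cont that by (intro continuous_intros) auto
  qed (use assms(3) in simp)
  have "SAV_energy \<epsilon> a b m (\<phi> (Suc k)) (r (Suc k)) - SAV_energy \<epsilon> a b m (\<phi> k) (r k)
      \<le> L2_inner a b (\<mu> k) (D k)" if "k < n" for k
  proof -
    have k: "k < N" using that n by simp
    have "SAV_energy \<epsilon> a b m (\<phi> (Suc k)) (r (Suc k)) - SAV_energy \<epsilon> a b m (\<phi> k) (r k) = L2_inner a b (\<mu> k) (D k)"
      unfolding D_def
    proof (rule SAV_energy_increment[where R = "SAV_root a b m C0 \<phi>m \<phi> k" and g = "dE1 m (extrapolate \<phi>m \<phi> k)"])
      show "0 < SAV_root a b m C0 \<phi>m \<phi> k"
        using sol k by (simp add: L1_SAV_solution_def SAV_root_def)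
      show "r (Suc k) - r k = 1 / (2 * SAV_root a b m C0 \<phi>m \<phi> k)
          * L2_inner a b (dE1 m (extrapolate \<phi>m \<phi> k)) (\<lambda>x. \<phi> (Suc k) x - \<phi> k x)"
        using sol k by (simp add: L1_SAV_solution_def)
    qed (use k field \<mu>_cont in \<open>auto simp: \<mu>_def SAV_potential_def\<close>)
    then show ?thesis by simp
  qed
  moreover have "(\<Sum>k<n. L2_inner a b (\<mu> k) (D k)) \<le> 0"
  proof (rule scheme_dissipation[OF kernel n assms(3)])
    fix F k assume CH: "m = Cahn_Hilliard F" and k: "k < n"
    have per: "periodic_on_box a b (\<phi> j)" if "j \<le> Suc k" for j
      using that k n phase_field_D(1)[OF field] by simp
    moreover have "periodic_on_box a b \<phi>m"
      using sol by (simp add: L1_SAV_solution_def)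
    ultimately have "periodic_on_box a b (extrapolate \<phi>m \<phi> k)"
      by (simp add: periodic_on_box_def extrapolate_def)
    moreover have "periodic_on_box a b (laplacian (\<lambda>y. 1/2 * (\<phi> (k + 1) y + \<phi> k y)))"
      using per[of k] per[of "Suc k"] by (intro periodic_on_box_laplacian) (simp add: periodic_on_box_def)
    ultimately show "periodic_on_box a b (\<mu> k)"
      using CH by (simp add: periodic_on_box_def \<mu>_def SAV_potential_def)
  qed (use n D_cont admissible scheme in auto)
  ultimately show ?thesis
    by (rule energy_le_initial[where E = "\<lambda>k. SAV_energy \<epsilon> a b m (\<phi> k) (r k)"])
qed

end

theorem theorem4p1:
  fixes \<alpha> \<gamma> \<epsilon> T :: real and N :: nat and t :: "nat \<Rightarrow> real"
    and a b :: "'a::euclidean_space"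
  assumes "0 < \<alpha>" "\<alpha> < 1" "\<gamma> > 0" "\<epsilon> > 0" "T > 0"
    and "\<forall>i\<in>Basis. a \<bullet> i < b \<bullet> i"
    and "time_mesh T N t"
  shows
    "(\<forall>m S \<phi>.
        stabilized_model m S \<longrightarrow>
        stabilized_L1_solution \<alpha> \<gamma> \<epsilon> a b N t m S \<phi> \<longrightarrow>
        (m = Allen_Cahn \<longrightarrow> sup_norm a b (\<phi> 0) \<le> 1) \<longrightarrow>
        (\<forall>n\<in>{1..N}. classical_energy \<epsilon> a b m (\<phi> n) \<le> classical_energy \<epsilon> a b m (\<phi> 0)))
     \<and>
     (\<forall>m C0 \<phi>m \<phi> r.
        m \<in> {Allen_Cahn, Cahn_Hilliard double_well, MBE_slope, MBE_no_slope} \<longrightarrow>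
        C0 > 0 \<longrightarrow>
        L1_SAV_solution \<alpha> \<gamma> \<epsilon> a b N t m C0 \<phi>m \<phi> r \<longrightarrow>
        (\<forall>n\<in>{1..N}. SAV_energy \<epsilon> a b m (\<phi> n) (r n) \<le> SAV_energy \<epsilon> a b m (\<phi> 0) (r 0)))"
proof -
  interpret periodic_box a b
    using assms(6) by unfold_locales auto
  show ?thesis
    using stabilized_L1_energy_le[OF assms(1-3,7)] L1_SAV_energy_le[OF assms(1-3,7)] by simp
qed

end
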